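(* Suppose $\Lambda$ is a constrained Willmore surface. The uniqueness of the multiplier to $\Lambda$ is equivalent to $\Lambda$ being not isothermic.
   Context: $n\ge 3$; $\mathbb{R}^{n+1,1}$ has metric $(\,,\,)$ of signature $(n+1,1)$, extended complex bilinearly to $\mathbb{C}^{n+2}$; $\mathcal{L}$ is the set of non-zero null vectors of $\mathbb{R}^{n+1,1}$; $M$ is an oriented surface; $d$ is the trivial flat connection on $M\times\mathbb{R}^{n+1,1}$ and its complexification. The theory is local: restriction to a suitable non-empty open subset of $M$ is always understood. $\wedge^{2}\mathbb{R}^{n+1,1}\cong o(\mathbb{R}^{n+1,1})$ by $(v_1\wedge v_2)(w)=(w,v_1)v_2-(w,v_2)v_1$ (also complexified); $[\mu\wedge\eta](X,Y)=[\mu_X,\eta_Y]-[\mu_Y,\eta_X]$ for Lie-algebra-valued $1$-forms; $d^\nabla$ is the exterior derivative on endomorphism-valued forms. A surface is a null line subbundle $\Lambda\subset M\times\mathbb{R}^{n+1,1}$ defining an immersion $M\to\mathbb{P}(\mathcal{L})\cong S^n$ (standing assumption: not contained in any proper subsphere of $S^n$). $M$ carries the conformal structure of the metrics $g_\sigma(X,Y)=(d_X\sigma,d_Y\sigma)$, $\sigma\in\Gamma(\Lambda)$ never-zero, and $*\omega=-\omega\circ J$ on $1$-forms for the induced complex structure $J$. $\Lambda^{(1)}=\langle\sigma,d\sigma(TM)\rangle$; for a holomorphic chart $z$ the (complexified) central sphere congruence is $S=\langle\sigma,\sigma_z,\sigma_{\bar z},\sigma_{z\bar z}\rangle$. $\mathcal{D}:=\pi_S\circ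 d\circ\pi_S+\pi_{S^\perp}\circ d\circ\pi_{S^\perp}$, $\mathcal{N}:=d-\mathcal{D}$. A multiplier to $\Lambda$ is a real $q\in\Omega^1(\Lambda\wedge\Lambda^{(1)})$ with $d^{\mathcal{D}}q=0$ and $d^{\mathcal{D}}*\mathcal{N}=2[q\wedge*\mathcal{N}]$; $\Lambda$ is constrained Willmore if it admits a multiplier. $\Lambda$ is isothermic if there exists a non-zero closed ($d\eta=0$) real $1$-form $\eta$ with values in $\Lambda\wedge\Lambda^\perp$. *)

theory Defs
  imports "HOL-Analysis.Analysis"
begin

section \<open>Minkowski space\<close>

text \<open>Signature \<open>(n+1,1)\<close> when \<open>CARD('k) = n + 1\<close>: the coordinates \<open>Some i\<close> are spacelike, the
  coordinate \<open>None\<close> is timelike.\<close>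

type_synonym 'k minkowski = "real ^ ('k option)"
type_synonym 'k minkowski_end = "real ^ ('k option) ^ ('k option)"

definition mink :: "'k::finite minkowski \<Rightarrow> 'k minkowski \<Rightarrow> real" where
  "mink v w = (\<Sum>i\<in>UNIV. v $ Some i * w $ Some i) - v $ None * w $ None"

definition mink_perp :: "'k::finite minkowski set \<Rightarrow> 'k minkowski set" where
  "mink_perp W = {v. \<forall>w\<in>W. mink v w = 0}"

definition complexify :: "'k::finite minkowski \<Rightarrow> complex ^ ('k option)" where
  "complexify v = (\<chi> i. complex_of_real (v $ i))"

text \<open>Orthogonal projection onto a nondegenerate subspace.\<close>

definition proj :: "'k::finite minkowski set \<Rightarrow> 'k minkowski \<Rightarrow> 'k minkowski" where
  "proj W v = (THE w. w \<in> W \<and> v - w \<in> mink_perp W)"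

definition proj_perp :: "'k::finite minkowski set \<Rightarrow> 'k minkowski \<Rightarrow> 'k minkowski" where
  "proj_perp W v = v - proj W v"

text \<open>Bivectors are identified with skew endomorphisms, written as matrices.\<close>

definition wedge :: "'k::finite minkowski \<Rightarrow> 'k minkowski \<Rightarrow> 'k minkowski_end" where
  "wedge v1 v2 = matrix (\<lambda>w. mink w v1 *\<^sub>R v2 - mink w v2 *\<^sub>R v1)"

definition wedge_space ::
    "'k::finite minkowski set \<Rightarrow> 'k minkowski set \<Rightarrow> 'k minkowski_end set" where
  "wedge_space U W = span {wedge u w | u w. u \<in> U \<and> w \<in> W}"

definition lie :: "'k::finite minkowski_end \<Rightarrow> 'k minkowski_end \<Rightarrow> 'k minkowski_end" where
  "lie B C = B ** C - C ** B"


section \<open>Riemann surfaces\<close>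

text \<open>The surface is the whole type \<open>'m\<close>; a chart is a pair of a domain and a coordinate map.
  The atlas consists of holomorphic charts, so it carries both the orientation and the
  complex structure; the latter is tied to the immersion by \<open>conformal\<close> below.\<close>

type_synonym 'm chart = "'m set \<times> ('m \<Rightarrow> complex)"

definition chart_inv :: "'m chart \<Rightarrow> complex \<Rightarrow> 'm" where
  "chart_inv c = inv_into (fst c) (snd c)"

definition transition :: "'m chart \<Rightarrow> 'm chart \<Rightarrow> complex \<Rightarrow> complex" where
  "transition c c' = snd c' \<circ> chart_inv c"

definition riemann_surface ::
    "('m::{t2_space,second_countable_topology}) chart set \<Rightarrow> bool" where
  "riemann_surface A \<longleftrightarrow>
     (\<Union>c\<in>A. fst c) = UNIV \<and>
     (\<forall>c\<in>A. open (fst c) \<and> open (snd c ` fst c) \<and>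
        homeomorphism (fst c) (snd c ` fst c) (snd c) (chart_inv c)) \<and>
     (\<forall>c\<in>A. \<forall>c'\<in>A. transition c c' holomorphic_on snd c ` (fst c \<inter> fst c'))"

text \<open>\<open>C\<close>-\<open>k\<close> regularity on an open set, in the sense of real differentiability.\<close>

primrec ck_on :: "nat \<Rightarrow> complex set \<Rightarrow> (complex \<Rightarrow> 'b::real_normed_vector) \<Rightarrow> bool" where
  "ck_on 0 U f \<longleftrightarrow> continuous_on U f"
| "ck_on (Suc k) U f \<longleftrightarrow> f differentiable_on U \<and>
     (\<forall>X. ck_on k U (\<lambda>\<zeta>. frechet_derivative f (at \<zeta>) X))"

definition smooth_on :: "'m chart set \<Rightarrow> 'm set \<Rightarrow> ('m \<Rightarrow> 'b::real_normed_vector) \<Rightarrow> bool" where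
  "smooth_on A W f \<longleftrightarrow> (\<forall>c\<in>A. \<forall>k. ck_on k (snd c ` (fst c \<inter> W)) (f \<circ> chart_inv c))"

text \<open>The derivative \<open>d\<^sub>X f\<close> at \<open>p\<close>. The tangent vector \<open>X\<close> at \<open>p\<close> is given by its coordinates
  in the chart \<open>c\<close>, as an element of the real plane \<open>complex\<close>: \<open>\<partial>\<^sub>x\<close> is \<open>1\<close>, \<open>\<partial>\<^sub>y\<close> is \<open>\<i>\<close>, and
  the complex structure \<open>J\<close> is multiplication by \<open>\<i>\<close>.\<close>

definition dd :: "'m chart \<Rightarrow> ('m \<Rightarrow> 'b::real_normed_vector) \<Rightarrow> 'm \<Rightarrow> complex \<Rightarrow> 'b" where
  "dd c f p X = frechet_derivative (f \<circ> chart_inv c) (at (snd c p)) X"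

definition d_z :: "'m chart \<Rightarrow> ('m \<Rightarrow> complex ^ 'v::finite) \<Rightarrow> 'm \<Rightarrow> complex ^ 'v" where
  "d_z c f p = (1/2) *s (dd c f p 1 - \<i> *s dd c f p \<i>)"

definition d_zbar :: "'m chart \<Rightarrow> ('m \<Rightarrow> complex ^ 'v::finite) \<Rightarrow> 'm \<Rightarrow> complex ^ 'v" where
  "d_zbar c f p = (1/2) *s (dd c f p 1 + \<i> *s dd c f p \<i>)"

text \<open>An endomorphism-valued form is given by its expression in every chart of the atlas;
  \<open>\<omega> c p X\<close> is the value at \<open>p\<close> on the tangent vector with coordinates \<open>X\<close> in \<open>c\<close>. The last clause
  fixes the irrelevant values, so that equality of forms is equality of functions.\<close>

type_synonym ('m, 'k) form1 = "'m chart \<Rightarrow> 'm \<Rightarrow> complex \<Rightarrow> 'k minkowski_end"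
type_synonym ('m, 'k) form2 = "'m chart \<Rightarrow> 'm \<Rightarrow> complex \<Rightarrow> complex \<Rightarrow> 'k minkowski_end"

definition one_form :: "'m chart set \<Rightarrow> ('m, 'k::finite) form1 \<Rightarrow> bool" where
  "one_form A \<omega> \<longleftrightarrow>
     (\<forall>c\<in>A. \<forall>p\<in>fst c. linear (\<omega> c p)) \<and>
     (\<forall>c\<in>A. \<forall>X. smooth_on A (fst c) (\<lambda>p. \<omega> c p X)) \<and>
     (\<forall>c\<in>A. \<forall>c'\<in>A. \<forall>p\<in>fst c \<inter> fst c'. \<forall>X.
        \<omega> c p X = \<omega> c' p (deriv (transition c c') (snd c p) * X)) \<and>
     (\<forall>c p X. c \<notin> A \<or> p \<notin> fst c \<longrightarrow> \<omega> c p X = 0)"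

definition values_in :: "'m chart set \<Rightarrow> ('m, 'k::finite) form1 \<Rightarrow> ('m \<Rightarrow> 'k minkowski_end set) \<Rightarrow> bool"
  where "values_in A \<omega> E \<longleftrightarrow> (\<forall>c\<in>A. \<forall>p\<in>fst c. \<forall>X. \<omega> c p X \<in> E p)"

definition star :: "('m, 'k::finite) form1 \<Rightarrow> ('m, 'k) form1" where
  "star \<omega> c p X = - \<omega> c p (\<i> * X)"

definition lie_wedge :: "('m, 'k::finite) form1 \<Rightarrow> ('m, 'k) form1 \<Rightarrow> ('m, 'k) form2" where
  "lie_wedge \<mu> \<eta> c p X Y = lie (\<mu> c p X) (\<eta> c p Y) - lie (\<mu> c p Y) (\<eta> c p X)"

text \<open>Exterior derivatives are evaluated on vector fields with constant coordinates in the
  chart, whose Lie brackets vanish.\<close>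

definition ext_d :: "('m, 'k::finite) form1 \<Rightarrow> ('m, 'k) form2" where
  "ext_d \<omega> c p X Y = dd c (\<lambda>x. \<omega> c x Y) p X - dd c (\<lambda>x. \<omega> c x X) p Y"


section \<open>Surfaces in the conformal sphere\<close>

definition sections ::
    "'m chart set \<Rightarrow> ('m \<Rightarrow> 'k::finite minkowski set) \<Rightarrow> 'm set \<Rightarrow> ('m \<Rightarrow> 'k minkowski) set" where
  "sections A \<Lambda> W = {\<sigma>. smooth_on A W \<sigma> \<and> (\<forall>p\<in>W. \<sigma> p \<in> \<Lambda> p \<and> \<sigma> p \<noteq> 0)}"

text \<open>Never-zero smooth sections of \<open>\<Lambda>\<close> over some neighbourhood of \<open>p\<close>.\<close>

definition local_sections ::
    "('m::topological_space) chart set \<Rightarrow> ('m \<Rightarrow> 'k::finite minkowski set) \<Rightarrow> 'm \<Rightarrow>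
     ('m \<Rightarrow> 'k minkowski) set" where
  "local_sections A \<Lambda> p = (\<Union>W\<in>{W. open W \<and> p \<in> W}. sections A \<Lambda> W)"

definition null_line_bundle ::
    "('m::topological_space) chart set \<Rightarrow> ('m \<Rightarrow> 'k::finite minkowski set) \<Rightarrow> bool" where
  "null_line_bundle A \<Lambda> \<longleftrightarrow>
     (\<forall>p. (\<exists>v. v \<noteq> 0 \<and> mink v v = 0 \<and> \<Lambda> p = span {v}) \<and> local_sections A \<Lambda> p \<noteq> {})"

text \<open>The differential of \<open>M \<rightarrow> \<P>(\<L>)\<close> at \<open>p\<close> sends \<open>X\<close> to the homomorphism
  \<open>\<sigma> \<mapsto> d\<^sub>X \<sigma> mod \<Lambda>\<close>.\<close>

definition immersed ::
    "('m::topological_space) chart set \<Rightarrow> ('m \<Rightarrow> 'k::finite minkowski set) \<Rightarrow> bool" where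
  "immersed A \<Lambda> \<longleftrightarrow> (\<forall>c\<in>A. \<forall>p\<in>fst c. \<forall>\<sigma>\<in>local_sections A \<Lambda> p. \<forall>X.
     dd c \<sigma> p X \<in> \<Lambda> p \<longrightarrow> X = 0)"

definition induced_metric ::
    "'m chart \<Rightarrow> ('m \<Rightarrow> 'k::finite minkowski) \<Rightarrow> 'm \<Rightarrow> complex \<Rightarrow> complex \<Rightarrow> real" where
  "induced_metric c \<sigma> p X Y = mink (dd c \<sigma> p X) (dd c \<sigma> p Y)"

text \<open>The complex structure of the atlas is the one determined by the conformal class of the
  metrics \<open>g\<^sub>\<sigma>\<close> and the orientation: \<open>J\<close> is orthogonal, hence a rotation by a right angle.\<close>

definition conformal ::
    "('m::topological_space) chart set \<Rightarrow> ('m \<Rightarrow> 'k::finite minkowski set) \<Rightarrow> bool" where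
  "conformal A \<Lambda> \<longleftrightarrow> (\<forall>c\<in>A. \<forall>p\<in>fst c. \<forall>\<sigma>\<in>local_sections A \<Lambda> p. \<forall>X Y.
     induced_metric c \<sigma> p (\<i> * X) (\<i> * Y) = induced_metric c \<sigma> p X Y)"

text \<open>A sphere of dimension \<open>k\<close> in \<open>\<P>(\<L>)\<close> consists of the null lines in a subspace \<open>W\<close> of
  signature \<open>(k+1,1)\<close>; a subspace has such a signature iff it contains a timelike vector.\<close>

definition in_proper_subsphere :: "('m \<Rightarrow> 'k::finite minkowski set) \<Rightarrow> bool" where
  "in_proper_subsphere \<Lambda> \<longleftrightarrow>
     (\<exists>W. subspace W \<and> W \<noteq> UNIV \<and> (\<exists>t\<in>W. mink t t < 0) \<and> (\<forall>p. \<Lambda> p \<subseteq> W))"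

definition surface_in_sphere ::
    "('m::{t2_space,second_countable_topology}) chart set \<Rightarrow> ('m \<Rightarrow> 'k::finite minkowski set) \<Rightarrow> bool"
  where "surface_in_sphere A \<Lambda> \<longleftrightarrow> riemann_surface A \<and> null_line_bundle A \<Lambda> \<and>
     immersed A \<Lambda> \<and> conformal A \<Lambda> \<and> \<not> in_proper_subsphere \<Lambda>"

text \<open>The bundle \<open>\<Lambda>\<^sup>(\<^sup>1\<^sup>)\<close> and the central sphere congruence \<open>S\<close>. The spans below do not depend on the
  section \<open>\<sigma>\<close> nor on the chart \<open>c\<close>. The complexification of \<open>S\<close> is spanned by
  \<open>\<sigma>\<close>, \<open>\<sigma>\<^sub>z\<close>, its conjugate and the mixed second derivative of \<open>\<sigma>\<close>; \<open>S\<close> itself consists of the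
  real vectors in this span. The function \<open>span\<close> is the real span, \<open>vec.span\<close> the complex one.\<close>

definition first_derived ::
    "('m::topological_space) chart set \<Rightarrow> ('m \<Rightarrow> 'k::finite minkowski set) \<Rightarrow> 'm \<Rightarrow> 'k minkowski set"
  where "first_derived A \<Lambda> p =
     {v. \<exists>c\<in>A. p \<in> fst c \<and> (\<exists>\<sigma>\<in>local_sections A \<Lambda> p.
        v \<in> span (insert (\<sigma> p) (range (dd c \<sigma> p))))}"

definition central_sphere ::
    "('m::topological_space) chart set \<Rightarrow> ('m \<Rightarrow> 'k::finite minkowski set) \<Rightarrow> 'm \<Rightarrow> 'k minkowski set"
  where "central_sphere A \<Lambda> p =
     {v. \<exists>c\<in>A. p \<in> fst c \<and> (\<exists>\<sigma>\<in>local_sections A \<Lambda> p.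
        let s = complexify \<circ> \<sigma> in
          complexify v \<in> vec.span {s p, d_z c s p, d_zbar c s p, d_zbar c (d_z c s) p})}"

text \<open>The connection \<open>\<D>\<close> determined by a bundle \<open>S\<close> of nondegenerate subspaces, its action on
  endomorphisms, and the tensor \<open>\<N> = d - \<D>\<close>. The last two are tensorial in their argument, so
  that they can be computed on constant sections \<open>v\<close>.\<close>

definition conn_D ::
    "('m \<Rightarrow> 'k::finite minkowski set) \<Rightarrow> 'm chart \<Rightarrow> ('m \<Rightarrow> 'k minkowski) \<Rightarrow> 'm \<Rightarrow> complex \<Rightarrow> 'k minkowski"
  where "conn_D S c f p X =
     proj (S p) (dd c (\<lambda>x. proj (S x) (f x)) p X) +
     proj_perp (S p) (dd c (\<lambda>x. proj_perp (S x) (f x)) p X)"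

definition conn_D_end ::
    "('m \<Rightarrow> 'k::finite minkowski set) \<Rightarrow> 'm chart \<Rightarrow> ('m \<Rightarrow> 'k minkowski_end) \<Rightarrow> 'm \<Rightarrow> complex \<Rightarrow>
     'k minkowski_end" where
  "conn_D_end S c B p X =
     matrix (\<lambda>v. conn_D S c (\<lambda>x. B x *v v) p X - B p *v conn_D S c (\<lambda>_. v) p X)"

definition form_N :: "('m \<Rightarrow> 'k::finite minkowski set) \<Rightarrow> ('m, 'k) form1" where
  "form_N S c p X = matrix (\<lambda>v. dd c (\<lambda>_. v) p X - conn_D S c (\<lambda>_. v) p X)"

definition ext_D ::
    "('m \<Rightarrow> 'k::finite minkowski set) \<Rightarrow> ('m, 'k) form1 \<Rightarrow> ('m, 'k) form2" where
  "ext_D S \<mu> c p X Y =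
     conn_D_end S c (\<lambda>x. \<mu> c x Y) p X - conn_D_end S c (\<lambda>x. \<mu> c x X) p Y"

definition multiplier ::
    "('m::topological_space) chart set \<Rightarrow> ('m \<Rightarrow> 'k::finite minkowski set) \<Rightarrow> ('m, 'k) form1 \<Rightarrow> bool"
  where "multiplier A \<Lambda> q \<longleftrightarrow>
     one_form A q \<and>
     values_in A q (\<lambda>p. wedge_space (\<Lambda> p) (first_derived A \<Lambda> p)) \<and>
     (let S = central_sphere A \<Lambda>; sN = star (form_N S) in
        \<forall>c\<in>A. \<forall>p\<in>fst c. \<forall>X Y.
          ext_D S q c p X Y = 0 \<and>
          ext_D S sN c p X Y = 2 *\<^sub>R lie_wedge q sN c p X Y)"

definition constrained_willmore ::
    "('m::topological_space) chart set \<Rightarrow> ('m \<Rightarrow> 'k::finite minkowski set) \<Rightarrow> bool" where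
  "constrained_willmore A \<Lambda> \<longleftrightarrow> (\<exists>q. multiplier A \<Lambda> q)"

definition isothermic ::
    "('m::topological_space) chart set \<Rightarrow> ('m \<Rightarrow> 'k::finite minkowski set) \<Rightarrow> bool" where
  "isothermic A \<Lambda> \<longleftrightarrow> (\<exists>\<eta>.
     one_form A \<eta> \<and>
     values_in A \<eta> (\<lambda>p. wedge_space (\<Lambda> p) (mink_perp (\<Lambda> p))) \<and>
     (\<forall>c\<in>A. \<forall>p\<in>fst c. \<forall>X Y. ext_d \<eta> c p X Y = 0) \<and>
     (\<exists>c\<in>A. \<exists>p\<in>fst c. \<exists>X. \<eta> c p X \<noteq> 0))"

end

theory Submission
  imports Defs "HOL-Complex_Analysis.Complex_Analysis"
begin

text \<open>In a chart, let \<open>g\<close> be a section of \<open>\<Lambda>\<close>, \<open>a = g\<^sub>x\<close>, \<open>b = g\<^sub>y\<close> and \<open>E = (a, a)\<close>. Both for the difference of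
  two multipliers and for a closed form with values in \<open>\<Lambda> \<and> \<Lambda>\<^sup>\<bottom>\<close>, the part of the structure equation
  along \<open>S\<close> forces \<open>\<eta>\<^sub>x = g \<and> (\<alpha> a + \<beta> b)\<close>, \<open>\<eta>\<^sub>y = g \<and> (\<beta> a - \<alpha> b)\<close> with \<open>E (\<alpha> - \<i> \<beta>)\<close> holomorphic: the
  form is a holomorphic quadratic differential. For such forms \<open>d \<eta> = [\<N> \<and> \<eta>]\<close> and \<open>d *\<eta> = [\<N> \<and> *\<eta>]\<close>, so
  that \<open>d\<^sup>\<D> \<eta> = 0\<close> and \<open>d\<^sup>\<D> *\<eta> = 0\<close> hold automatically, and closedness of \<open>*\<eta>\<close> is the equation
  \<open>[\<eta> \<and> *\<N>] = - [\<N> \<and> *\<eta>] = 0\<close>. Hence \<open>*\<close> exchanges differences of multipliers and the forms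
  that make \<open>\<Lambda>\<close> isothermic.\<close>

section \<open>Minkowski space\<close>

text \<open>The multiplier equations are inhomogeneous linear, so the constrained Willmore
  hypothesis supplies one solution and uniqueness means that the homogeneous equations have only the
  zero solution. The two kinds of form obey different equations,
  \<open>d \<eta> = [\<N> \<and> \<eta>]\<close> and \<open>d \<eta> = 0\<close>. Both are instances
  of \<open>d \<eta> = c [\<N> \<and> \<eta>]\<close>, and one argument serves both: the bracket is
  \<open>g\<close> wedged with a vector normal to \<open>S\<close>, the Cauchy-Riemann terms are
  \<open>g\<close> wedged with combinations of \<open>a\<close> and \<open>b\<close>, so
  \<open>c\<close> never meets the latter. That the normal part of \<open>d \<eta>\<close> is
  exactly the bracket rests on \<open>S\<close> being the central sphere congruence: it contains the
  Laplacian of \<open>g\<close>, hence the normal parts of \<open>g\<close>'s two pure second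
  derivatives are opposite. The obstacle is the form of the definitions: \<open>S\<close> is a union
  over all charts and sections, and its projection is given by description. Independence of the
  choices and an explicit differentiable projection must come before any computation. Holomorphicity
  enters only as a pair of pointwise equations, so everything is checked chart by chart near each
  point.\<close>

lemma bilinear_mink: "bilinear (mink :: 'k::finite minkowski \<Rightarrow> _)"
  unfolding bilinear_def mink_def
  by (auto intro!: linearI simp: algebra_simps sum.distrib sum_distrib_left)

interpretation mink: bounded_bilinear "mink :: 'k::finite minkowski \<Rightarrow> _"
  using bilinear_mink bilinear_conv_bounded_bilinear by blast

lemmas mink_simps = mink.add_left mink.add_right mink.diff_left mink.diff_right
  mink.minus_left mink.minus_right mink.scaleR_left mink.scaleR_right mink.zero_left mink.zero_right

lemma mink_commute: "mink v w = mink w v"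
  by (simp add: mink_def mult.commute)

text \<open>Without a time part the norm is a sum of squares. Sections of \<open>\<Lambda>\<close>
  can therefore be normalised by their coordinate \<open>None\<close> wherever they are
  defined.\<close>

lemma mink_eq_0_imp_time_nz:
  assumes "mink u u = 0" "u \<noteq> 0"
  shows "u $ None \<noteq> 0"
proof
  assume 0: "u $ None = 0"
  then have "(\<Sum>i\<in>UNIV. u $ Some i * u $ Some i) = 0"
    using assms by (simp add: mink_def)
  then have "\<forall>i. u $ Some i = 0"
    by (subst (asm) sum_nonneg_eq_0_iff) auto
  with 0 have "u = 0"
    by (metis vec_eq_iff zero_index option.exhaust)
  with assms show False by simp
qed

text \<open>Subtract the multiple of \<open>u\<close> that kills the time coordinate: the norm is
  unchanged because \<open>u\<close> is null and orthogonal to \<open>v\<close>, and what remains is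
  nonzero and purely spacelike.\<close>

lemma mink_pos_of_perp_null:
  assumes u: "mink u u = 0" "u \<noteq> 0" and "mink u v = 0" and "v \<notin> span {u}"
  shows "mink v v > 0"
proof -
  define x where "x = v - (v $ None / u $ None) *\<^sub>R u"
  have xN: "x $ None = 0"
    using mink_eq_0_imp_time_nz[OF u] by (simp add: x_def)
  have "x \<noteq> 0"
  proof
    assume "x = 0"
    then have "v = (v $ None / u $ None) *\<^sub>R u" by (simp add: x_def)
    then show False using assms(4) by (metis span_base span_scale singletonI)
  qed
  then have "mink x x \<noteq> 0"
    using mink_eq_0_imp_time_nz xN by blast
  moreover have "mink x x \<ge> 0"
    by (simp add: mink_def xN sum_nonneg)
  moreover have "mink x x = mink v v"
    using u assms(3) mink_commute[of u v] by (simp add: x_def mink_simps)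
  ultimately show ?thesis by simp
qed

lemma mink_null_perp_null:
  assumes "mink u u = 0" "u \<noteq> 0" "mink u v = 0" "mink v v = 0"
  shows "v \<in> span {u}"
  using mink_pos_of_perp_null[of u v] assms by fastforce

lemma subspace_mink_perp: "subspace (mink_perp W)"
  by (auto simp: subspace_def mink_perp_def mink_simps)

lemma mink_axis_None: "mink (axis None 1) u = - u $ None"
  by (simp add: mink_def axis_def)

lemma mink_nondegenerate:
  assumes "\<And>w. mink w v = 0"
  shows "v = 0"
proof -
  have "v $ i = 0" for i
  proof (cases i)
    case None
    then show ?thesis using assms[of "axis None 1"] by (simp add: mink_axis_None)
  next
    case (Some j)
    have "mink (axis (Some j) 1) v = (\<Sum>k\<in>UNIV. if k = j then v $ Some k else 0)"
      unfolding mink_def by (auto simp: axis_def if_distrib[of "\<lambda>x. x * _"] cong: if_cong intro!: sum.cong)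
    then show ?thesis using assms[of "axis (Some j) 1"] Some by simp
  qed
  then show ?thesis by (simp add: vec_eq_iff)
qed


section \<open>Rank one endomorphisms and bivectors\<close>

text \<open>Antisymmetric combinations of these are the bivectors, symmetric ones will give the
  projection \<open>P\<close> as an explicit matrix.\<close>

definition ten :: "'k::finite minkowski \<Rightarrow> 'k minkowski \<Rightarrow> 'k minkowski_end" where
  "ten u w = matrix (\<lambda>v. mink v u *\<^sub>R w)"

lemma matrix_apply: "linear f \<Longrightarrow> matrix f *v v = f v"
  for f :: "real ^ 'a::finite \<Rightarrow> real ^ 'b::finite"
  by (metis matrix_vector_mul(2))

lemma ten_apply: "ten u w *v v = mink v u *\<^sub>R w"
  unfolding ten_def
  by (rule matrix_apply) (auto intro!: linearI simp: mink_simps algebra_simps)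

lemma matrix_eqI: "(\<And>v. B *v v = C *v v) \<Longrightarrow> B = C"
  for B C :: "real ^ 'a::finite ^ 'b::finite"
  by (simp add: matrix_eq)

lemma bilinear_ten: "bilinear (ten :: 'k::finite minkowski \<Rightarrow> _)"
  unfolding bilinear_def
  by (auto intro!: linearI matrix_eqI
      simp: ten_apply matrix_vector_mult_add_rdistrib scaleR_matrix_vector_assoc[symmetric]
        mink_simps algebra_simps)

interpretation ten: bounded_bilinear "ten :: 'k::finite minkowski \<Rightarrow> _"
  using bilinear_ten bilinear_conv_bounded_bilinear by blast

lemma wedge_conv_ten: "wedge u w = ten u w - ten w u"
proof (rule matrix_eqI)
  fix v
  have "wedge u w *v v = mink v u *\<^sub>R w - mink v w *\<^sub>R u"
    unfolding wedge_def
    by (rule matrix_apply) (auto intro!: linearI simp: mink_simps algebra_simps)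
  then show "wedge u w *v v = (ten u w - ten w u) *v v"
    by (simp add: ten_apply matrix_vector_mult_diff_rdistrib)
qed

lemma wedge_apply: "wedge u w *v v = mink v u *\<^sub>R w - mink v w *\<^sub>R u"
  by (simp add: wedge_conv_ten ten_apply matrix_vector_mult_diff_rdistrib)

lemma bilinear_wedge: "bilinear (wedge :: 'k::finite minkowski \<Rightarrow> _)"
  unfolding bilinear_def wedge_conv_ten
  by (auto intro!: linearI simp: ten.add_left ten.add_right ten.scaleR_left ten.scaleR_right
      algebra_simps)

interpretation wedge: bounded_bilinear "wedge :: 'k::finite minkowski \<Rightarrow> _"
  using bilinear_wedge bilinear_conv_bounded_bilinear by blast

lemmas wedge_simps = wedge.add_left wedge.add_right wedge.diff_left wedge.diff_right
  wedge.minus_left wedge.minus_right wedge.scaleR_left wedge.scaleR_right wedge.zero_left wedge.zero_right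

lemma wedge_self [simp]: "wedge u u = 0"
  by (simp add: wedge_conv_ten)

lemma wedge_swap: "wedge u w = - wedge w u"
  by (simp add: wedge_conv_ten)

lemma wedge_eq_0_imp_span:
  assumes "wedge u w = 0" "u \<noteq> 0"
  shows "w \<in> span {u}"
proof -
  obtain v where v: "mink v u \<noteq> 0" using mink_nondegenerate assms(2) by blast
  have "mink v u *\<^sub>R w = mink v w *\<^sub>R u"
    using wedge_apply[of u w v] assms(1) by simp
  then have "(1 / mink v u) *\<^sub>R (mink v u *\<^sub>R w) = (1 / mink v u) *\<^sub>R (mink v w *\<^sub>R u)"
    by simp
  then have "w = (mink v w / mink v u) *\<^sub>R u"
    using v by simp
  then show ?thesis by (metis span_base span_scale singletonI)
qed

text \<open>A sum of bivectors sharing the factor \<open>u\<close> is again one bivector with this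
  factor, so passing to the span adds nothing, and a form with such values has a single vector as
  coefficient.\<close>

lemma wedge_space_line:
  assumes "subspace W" "u \<noteq> 0"
  shows "wedge_space (span {u}) W = {wedge u t | t. t \<in> W}"
proof -
  have "{wedge v w | v w. v \<in> span {u} \<and> w \<in> W} = wedge u ` W"
  proof (intro equalityI subsetI)
    fix x assume "x \<in> {wedge v w | v w. v \<in> span {u} \<and> w \<in> W}"
    then obtain k w where "w \<in> W" "x = wedge (k *\<^sub>R u) w"
      by (auto simp: span_singleton)
    then have "x = wedge u (k *\<^sub>R w)" "k *\<^sub>R w \<in> W"
      using assms by (auto simp: wedge_simps subspace_scale)
    then show "x \<in> wedge u ` W" by blast
  next
    fix x assume "x \<in> wedge u ` W"
    then show "x \<in> {wedge v w | v w. v \<in> span {u} \<and> w \<in> W}"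
      using span_base by fastforce
  qed
  moreover have "subspace (wedge u ` W)"
    using assms(1) by (intro linear_subspace_image wedge.bounded_linear_right[THEN bounded_linear.linear])
  ultimately show ?thesis
    unfolding wedge_space_def by (simp add: span_eq_iff[THEN iffD2] Setcompr_eq_image)
qed

lemma bilinear_matrix_vector_mult:
  "bilinear (\<lambda>(B :: real ^ 'a::finite ^ 'b::finite) v. B *v v)"
  unfolding bilinear_def
  by (auto intro!: linearI simp: matrix_vector_mult_add_rdistrib matrix_vector_right_distrib
      scaleR_matrix_vector_assoc[symmetric] matrix_vector_mult_scaleR)

interpretation mvm: bounded_bilinear "\<lambda>(B :: real ^ 'a::finite ^ 'b::finite) v. B *v v"
  using bilinear_matrix_vector_mult bilinear_conv_bounded_bilinear by blast

lemma lie_apply: "lie B C *v v = B *v (C *v v) - C *v (B *v v)"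
  by (simp add: lie_def matrix_vector_mult_diff_rdistrib matrix_vector_mul_assoc)

lemma bilinear_lie: "bilinear (lie :: 'k::finite minkowski_end \<Rightarrow> _)"
  unfolding bilinear_def
  by (auto intro!: linearI matrix_eqI
      simp: lie_apply mvm.add_left mvm.add_right mvm.scaleR_left mvm.scaleR_right algebra_simps)

interpretation lie: bounded_bilinear "lie :: 'k::finite minkowski_end \<Rightarrow> _"
  using bilinear_lie bilinear_conv_bounded_bilinear by blast

lemma lie_skew: "lie B C = - lie C B"
  by (simp add: lie_def)

text \<open>Moving \<open>B\<close> across \<open>mink\<close> costs a sign, which turns the
  commutator into a Leibniz rule.\<close>

lemma lie_wedge_skew:
  assumes "\<And>u v. mink (B *v u) v = - mink u (B *v v)"
  shows "lie B (wedge u w) = wedge (B *v u) w + wedge u (B *v w)"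
  by (rule matrix_eqI)
    (simp add: lie_apply wedge_apply assms mvm.diff_right mvm.scaleR_right mvm.add_left)


section \<open>Partial derivatives in the plane\<close>

definition pd :: "complex \<Rightarrow> (complex \<Rightarrow> 'b::real_normed_vector) \<Rightarrow> complex \<Rightarrow> 'b" where
  "pd X f z = frechet_derivative f (at z) X"

lemma pd_eqI: "(f has_derivative F) (at z) \<Longrightarrow> pd X f z = F X"
  unfolding pd_def by (metis frechet_derivative_at)

lemma has_derivative_pd: "f differentiable (at z) \<Longrightarrow> (f has_derivative (\<lambda>X. pd X f z)) (at z)"
  unfolding pd_def by (simp add: frechet_derivative_works[symmetric])

lemma linear_pd: "f differentiable (at z) \<Longrightarrow> linear (\<lambda>X. pd X f z)"
  using has_derivative_pd has_derivative_linear by blast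

lemma linear_complex_expand:
  assumes "linear F"
  shows "F X = Re X *\<^sub>R F 1 + Im X *\<^sub>R F \<i>"
proof -
  have "F X = F (Re X *\<^sub>R 1 + Im X *\<^sub>R \<i>)"
    by (rule arg_cong[of _ _ F]) (simp add: complex_eq_iff)
  then show ?thesis using assms by (simp add: linear_add linear_scale)
qed

lemma pd_expand:
  "f differentiable (at z) \<Longrightarrow> pd X f z = Re X *\<^sub>R pd 1 f z + Im X *\<^sub>R pd \<i> f z"
  using linear_complex_expand[OF linear_pd] .

lemma pd_cong:
  assumes "open U" "z \<in> U" "\<And>x. x \<in> U \<Longrightarrow> f x = h x"
  shows "pd X f z = pd X h z"
proof -
  have "(f has_derivative F) (at z) \<longleftrightarrow> (h has_derivative F) (at z)" for F
    using assms has_derivative_transform_within_open[of _ _ z UNIV U] by metis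
  then show ?thesis unfolding pd_def frechet_derivative_def by simp
qed

lemma differentiable_cong:
  assumes "open U" "z \<in> U" "\<And>x. x \<in> U \<Longrightarrow> f x = h x" "h differentiable (at z)"
  shows "f differentiable (at z)"
  using assms has_derivative_transform_within_open[of h _ z UNIV U f]
  unfolding differentiable_def by metis

lemma pd_const [simp]: "pd X (\<lambda>_. v) z = 0"
  by (simp add: pd_def)

lemma pd_add:
  "f differentiable (at z) \<Longrightarrow> h differentiable (at z) \<Longrightarrow>
    pd X (\<lambda>x. f x + h x) z = pd X f z + pd X h z"
  by (rule pd_eqI) (intro has_derivative_add has_derivative_pd)

lemma pd_diff:
  "f differentiable (at z) \<Longrightarrow> h differentiable (at z) \<Longrightarrow>
    pd X (\<lambda>x. f x - h x) z = pd X f z - pd X h z"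
  by (rule pd_eqI) (intro has_derivative_diff has_derivative_pd)

lemma pd_minus:
  "f differentiable (at z) \<Longrightarrow> pd X (\<lambda>x. - f x) z = - pd X f z"
  by (rule pd_eqI) (intro has_derivative_minus has_derivative_pd)

lemma (in bounded_linear) pd:
  "h differentiable (at z) \<Longrightarrow> pd X (\<lambda>x. f (h x)) z = f (pd X h z)"
  by (rule pd_eqI) (intro has_derivative has_derivative_pd)

lemma (in bounded_linear) differentiable:
  "h differentiable F \<Longrightarrow> (\<lambda>x. f (h x)) differentiable F"
  unfolding differentiable_def using has_derivative by blast

lemma (in bounded_bilinear) pd:
  "f differentiable (at z) \<Longrightarrow> h differentiable (at z) \<Longrightarrow>
    pd X (\<lambda>x. prod (f x) (h x)) z = prod (f z) (pd X h z) + prod (pd X f z) (h z)"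
  by (rule pd_eqI) (intro FDERIV has_derivative_pd)

lemma (in bounded_bilinear) differentiable:
  "f differentiable (at z) \<Longrightarrow> h differentiable (at z) \<Longrightarrow>
    (\<lambda>x. prod (f x) (h x)) differentiable (at z)"
  unfolding differentiable_def using FDERIV by blast

lemma pd_compose:
  assumes "f differentiable (at z)" "h differentiable (at (f z))"
  shows "pd X (\<lambda>x. h (f x)) z = pd (pd X f z) h (f z)"
  by (rule pd_eqI) (rule has_derivative_compose[OF has_derivative_pd[OF assms(1)] has_derivative_pd[OF assms(2)]])

text \<open>Young's theorem: the second difference of \<open>f\<close> in the directions \<open>u\<close>, \<open>v\<close> is symmetric, and
  by the mean value inequality it is \<open>h\<^sup>2\<close> times the iterated derivative up to \<open>o(h\<^sup>2)\<close>.\<close>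

lemma second_difference:
  fixes f :: "complex \<Rightarrow> 'b::real_normed_vector"
  assumes U: "open U" "z \<in> U" and f: "\<And>x. x \<in> U \<Longrightarrow> f differentiable (at x)"
    and a: "pd u f differentiable (at z)" and e: "e > 0"
  shows "\<forall>\<^sub>F h in at_right 0. norm (f (z + of_real h * u + of_real h * v) - f (z + of_real h * u)
    - f (z + of_real h * v) + f z - h^2 *\<^sub>R pd v (pd u f) z) \<le> e * h^2"
proof -
  \<comment> \<open>Two errors, each at most \<open>e / n\<close> times
    \<open>h * (norm u + norm v)\<close>, must add up to at most \<open>e * h\<close>; the summand 1
    keeps \<open>n\<close> positive when \<open>u\<close> and \<open>v\<close> are 0.\<close>
  define n where "n = 2 * (norm u + norm v) + 1"
  have n: "n > 0" by (simp add: n_def add_nonneg_pos)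
  define A where "A = (\<lambda>X. pd X (pd u f) z)"
  have linA: "linear A" unfolding A_def using a by (rule linear_pd)
  have "(pd u f has_derivative A) (at z)"
    unfolding A_def using a by (rule has_derivative_pd)
  then obtain d where d: "d > 0"
    and dA: "\<And>x. norm (x - z) < d \<Longrightarrow> norm (pd u f x - pd u f z - A (x - z)) \<le> (e / n) * norm (x - z)"
    using e n unfolding has_derivative_at_alt by (metis divide_pos_pos)
  obtain r where r: "r > 0" "ball z r \<subseteq> U" using U open_contains_ball by blast
  define m where "m = min d r / n"
  have m: "m > 0" using d r n by (simp add: m_def)
  have main: "norm (f (z + of_real h * u + of_real h * v) - f (z + of_real h * u)
    - f (z + of_real h * v) + f z - h^2 *\<^sub>R A v) \<le> e * h^2" if h: "0 < h" "h < m" for h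
  proof -
    have hn: "h * n < min d r" using h n unfolding m_def by (simp add: pos_less_divide_eq)
    \<comment> \<open>The increment of \<open>k\<close> over \<open>{0..h}\<close> is the whole
      expression to be estimated, and the derivative of \<open>k\<close> compares
      \<open>pd u f\<close> at two points, which differentiability of \<open>pd u f\<close> at
      \<open>z\<close> controls.\<close>
    define k where "k = (\<lambda>t. f (z + of_real t * u + of_real h * v) - f (z + of_real t * u)
      - (t * h) *\<^sub>R A v)"
    have small: "norm (of_real t * u + of_real s * v) \<le> h * (norm u + norm v)"
      if "0 \<le> t" "t \<le> h" "0 \<le> s" "s \<le> h" for t s
    proof -
      have "norm (of_real t * u + of_real s * v) \<le> t * norm u + s * norm v"
        using that by (intro order.trans[OF norm_triangle_ineq]) (simp add: norm_mult)
      also have "\<dots> \<le> h * norm u + h * norm v"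
        using that by (intro add_mono mult_right_mono) auto
      finally show ?thesis by (simp add: algebra_simps)
    qed
    have lt: "h * (norm u + norm v) < min d r"
    proof -
      have "h * (norm u + norm v) \<le> h * n" using h by (simp add: n_def)
      then show ?thesis using hn by linarith
    qed
    have inU: "z + of_real t * u + of_real s * v \<in> U"
      if "0 \<le> t" "t \<le> h" "0 \<le> s" "s \<le> h" for t s
    proof -
      have "dist z (z + of_real t * u + of_real s * v) = norm (of_real t * u + of_real s * v)"
        by (metis (no_types) add.assoc add_diff_cancel_left' dist_commute dist_norm)
      then have "z + of_real t * u + of_real s * v \<in> ball z r"
        using small[OF that] lt by simp
      then show ?thesis using r by blast
    qed
    have app: "norm (pd u f (z + of_real t * u + of_real s * v) - pd u f z
        - A (of_real t * u + of_real s * v)) \<le> (e / n) * (h * (norm u + norm v))"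
      if "0 \<le> t" "t \<le> h" "0 \<le> s" "s \<le> h" for t s
    proof -
      have eq: "z + of_real t * u + of_real s * v - z = of_real t * u + of_real s * v" by simp
      have "norm (pd u f (z + of_real t * u + of_real s * v) - pd u f z
        - A (of_real t * u + of_real s * v)) \<le> (e / n) * norm (of_real t * u + of_real s * v)"
        using dA[of "z + of_real t * u + of_real s * v"] small[OF that] lt unfolding eq by auto
      also have "\<dots> \<le> (e / n) * (h * (norm u + norm v))"
        using small[OF that] e n by (intro mult_left_mono) auto
      finally show ?thesis .
    qed
    have der: "(k has_derivative (\<lambda>x. x *\<^sub>R (pd u f (z + of_real t * u + of_real h * v)
        - pd u f (z + of_real t * u) - h *\<^sub>R A v))) (at t within {0..h})" if t: "t \<in> {0..h}" for t
    proof -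
      have 1: "((\<lambda>t. z + of_real t * u + of_real h * v) has_derivative (\<lambda>x. of_real x * u)) (at t)"
        "((\<lambda>t. z + of_real t * u) has_derivative (\<lambda>x. of_real x * u)) (at t)"
        by (auto intro!: derivative_eq_intros)
      have sc: "pd (of_real x * u) f y = x *\<^sub>R pd u f y" if "y \<in> U" for x y
        using linear_scale[OF linear_pd[OF f[OF that]], of x u] by (simp add: scaleR_conv_of_real)
      have y: "z + of_real t * u + of_real h * v \<in> U" "z + of_real t * u \<in> U"
        using inU[of t h] inU[of t 0] t h by auto
      have 2: "((\<lambda>t. f (z + of_real t * u + of_real h * v)) has_derivative
          (\<lambda>x. x *\<^sub>R pd u f (z + of_real t * u + of_real h * v))) (at t)"
        using has_derivative_compose[OF 1(1) has_derivative_pd[OF f[OF y(1)]]] by (simp add: sc y)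
      have 3: "((\<lambda>t. f (z + of_real t * u)) has_derivative
          (\<lambda>x. x *\<^sub>R pd u f (z + of_real t * u))) (at t)"
        using has_derivative_compose[OF 1(2) has_derivative_pd[OF f[OF y(2)]]] by (simp add: sc y)
      have 4: "((\<lambda>t. (t * h) *\<^sub>R A v) has_derivative (\<lambda>x. (x * h) *\<^sub>R A v)) (at t)"
        by (auto intro!: derivative_eq_intros)
      have "(k has_derivative (\<lambda>x. x *\<^sub>R pd u f (z + of_real t * u + of_real h * v)
        - x *\<^sub>R pd u f (z + of_real t * u) - (x * h) *\<^sub>R A v)) (at t)"
        unfolding k_def by (intro has_derivative_diff 2 3 4)
      then show ?thesis by (auto simp: algebra_simps intro: has_derivative_at_withinI)
    qed
    have bnd: "onorm (\<lambda>x. x *\<^sub>R (pd u f (z + of_real t * u + of_real h * v)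
        - pd u f (z + of_real t * u) - h *\<^sub>R A v)) \<le> e * h" if t: "t \<in> {0..h}" for t
    proof (rule onorm_le)
      fix x :: real
      let ?p = "pd u f (z + of_real t * u + of_real h * v)" and ?q = "pd u f (z + of_real t * u)"
      have Aeq: "A (of_real t * u + of_real h * v) = A (of_real t * u) + h *\<^sub>R A v"
        using linear_scale[OF linA, of h v] by (simp add: linear_add[OF linA] scaleR_conv_of_real)
      have "?p - ?q - h *\<^sub>R A v = (?p - pd u f z - A (of_real t * u + of_real h * v))
        - (?q - pd u f z - A (of_real t * u + of_real 0 * v))"
        unfolding Aeq by simp
      also have "norm \<dots> \<le> (e / n) * (h * (norm u + norm v)) + (e / n) * (h * (norm u + norm v))"
        using app[of t h] app[of t 0] t h
        by (intro order.trans[OF norm_triangle_ineq4 add_mono]) auto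
      also have "\<dots> = e * h * ((2 * (norm u + norm v)) / n)"
        by (simp add: field_simps)
      also have "\<dots> \<le> e * h * 1"
        using e h n by (intro mult_left_mono) (auto simp: n_def divide_le_eq_1)
      finally have "norm (?p - ?q - h *\<^sub>R A v) \<le> e * h" by simp
      then show "norm (x *\<^sub>R (?p - ?q - h *\<^sub>R A v)) \<le> e * h * norm x"
        by (simp add: mult.commute mult_left_mono)
    qed
    have "norm (k h - k 0) \<le> e * h * norm (h - 0)"
      by (rule differentiable_bound[where S = "{0..h}", OF _ der bnd]) (use h in auto)
    moreover have "k h - k 0 = f (z + of_real h * u + of_real h * v) - f (z + of_real h * u)
    - f (z + of_real h * v) + f z - h^2 *\<^sub>R A v"
      by (simp add: k_def power2_eq_square)
    ultimately show ?thesis using h by (simp add: power2_eq_square mult.assoc)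
  qed
  show ?thesis
    unfolding eventually_at_right_field using main m A_def by auto
qed

lemma pd_commute:
  fixes f :: "complex \<Rightarrow> 'b::real_normed_vector"
  assumes U: "open U" "z \<in> U" and f: "\<And>x. x \<in> U \<Longrightarrow> f differentiable (at x)"
    and a: "pd u f differentiable (at z)" and b: "pd v f differentiable (at z)"
  shows "pd v (pd u f) z = pd u (pd v f) z"
proof -
  have "norm (pd v (pd u f) z - pd u (pd v f) z) \<le> e" if "e > 0" for e
  proof -
    have e2: "e / 2 > 0" using that by simp
    note sd = second_difference[OF U _ a e2, of v] second_difference[OF U _ b e2, of u]
    have "\<forall>\<^sub>F h in at_right (0::real). h > 0 \<and> norm (pd v (pd u f) z - pd u (pd v f) z) \<le> e"
      using sd(1)[OF f, simplified] sd(2)[OF f, simplified] eventually_at_right_less[of "0::real"]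
    proof eventually_elim
      case (elim h)
      let ?D = "f (z + of_real h * u + of_real h * v) - f (z + of_real h * u)
        - f (z + of_real h * v) + f z"
      have 1: "norm (?D - h^2 *\<^sub>R pd v (pd u f) z) \<le> e / 2 * h^2" using elim by simp
      have eq: "f (z + of_real h * v + of_real h * u) - f (z + of_real h * v)
        - f (z + of_real h * u) + f z = ?D" by (simp add: algebra_simps)
      have 2: "norm (?D - h^2 *\<^sub>R pd u (pd v f) z) \<le> e / 2 * h^2"
        using elim(2) unfolding eq by simp
      have "h^2 * norm (pd v (pd u f) z - pd u (pd v f) z)
        = norm ((?D - h^2 *\<^sub>R pd u (pd v f) z) - (?D - h^2 *\<^sub>R pd v (pd u f) z))"
        by (simp add: scaleR_diff_right[symmetric])
      also have "\<dots> \<le> e / 2 * h^2 + e / 2 * h^2"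
        using 1 2 norm_triangle_le_diff add_mono by (metis (no_types, lifting) add.commute)
      finally show ?case using elim(3) by (simp add: mult.commute)
    qed
    then show ?thesis
      using eventually_happens'[OF trivial_limit_at_right_real] by blast
  qed
  then have "norm (pd v (pd u f) z - pd u (pd v f) z) \<le> 0"
    using field_le_epsilon[of "norm (pd v (pd u f) z - pd u (pd v f) z)" 0] by simp
  then show ?thesis by simp
qed

lemma ck_on_Suc_iff:
  "open U \<Longrightarrow> ck_on (Suc k) U f \<longleftrightarrow>
    (\<forall>z\<in>U. f differentiable (at z)) \<and> (\<forall>X. ck_on k U (pd X f))"
  unfolding ck_on.simps by (subst differentiable_on_eq_differentiable_at) (auto simp: pd_def[abs_def])

lemma ck_on_cong:
  assumes "open U" "\<And>z. z \<in> U \<Longrightarrow> f z = h z"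
  shows "ck_on k U f \<longleftrightarrow> ck_on k U h"
  using assms(2)
proof (induction k arbitrary: f h)
  case 0
  then show ?case using continuous_on_cong[of U U f h] by simp
next
  case (Suc k)
  have "ck_on k U (pd X f) \<longleftrightarrow> ck_on k U (pd X h)" for X
    using Suc.prems assms(1) by (intro Suc.IH pd_cong) auto
  moreover have "(\<forall>z\<in>U. f differentiable (at z)) \<longleftrightarrow> (\<forall>z\<in>U. h differentiable (at z))"
    using differentiable_cong[OF assms(1)] Suc.prems by metis
  ultimately show ?case using assms(1) by (simp only: ck_on_Suc_iff)
qed

lemma ck_on_add:
  assumes "open U" "ck_on k U f" "ck_on k U h"
  shows "ck_on k U (\<lambda>z. f z + h z)"
  using assms(2,3)
proof (induction k arbitrary: f h)
  case 0
  then show ?case by (auto intro: continuous_on_add)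
next
  case (Suc k)
  have "ck_on k U (pd X (\<lambda>z. f z + h z)) \<longleftrightarrow> ck_on k U (\<lambda>z. pd X f z + pd X h z)" for X
    using Suc.prems assms(1) by (intro ck_on_cong pd_add) (auto simp: ck_on_Suc_iff simp del: ck_on.simps)
  with Suc show ?case using assms(1)
    by (auto simp: ck_on_Suc_iff simp del: ck_on.simps)
qed

lemma ck_on_minus:
  assumes "open U" "ck_on k U f"
  shows "ck_on k U (\<lambda>z. - f z)"
  using assms(2)
proof (induction k arbitrary: f)
  case 0
  then show ?case by (auto intro: continuous_on_minus)
next
  case (Suc k)
  have "ck_on k U (pd X (\<lambda>z. - f z)) \<longleftrightarrow> ck_on k U (\<lambda>z. - pd X f z)" for X
    using Suc.prems assms(1) by (intro ck_on_cong pd_minus) (auto simp: ck_on_Suc_iff simp del: ck_on.simps)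
  with Suc show ?case using assms(1)
    by (auto simp: ck_on_Suc_iff simp del: ck_on.simps)
qed

lemma ck_on_1D:
  assumes "open U" "ck_on 1 U f" "z \<in> U"
  shows "f differentiable (at z)"
  using assms unfolding One_nat_def by (subst (asm) ck_on_Suc_iff) auto

lemma ck_on_2D:
  assumes "open U" "ck_on 2 U f" "z \<in> U"
  shows "f differentiable (at z)" "pd X f differentiable (at z)" "pd \<i> (pd 1 f) z = pd 1 (pd \<i> f) z"
proof -
  have *: "\<forall>z\<in>U. f differentiable (at z)" "\<forall>X. \<forall>z\<in>U. pd X f differentiable (at z)"
    using assms(2) unfolding numeral_2_eq_2 ck_on_Suc_iff[OF assms(1)] by blast+
  then show "f differentiable (at z)" "pd X f differentiable (at z)"
    using assms by auto
  show "pd \<i> (pd 1 f) z = pd 1 (pd \<i> f) z"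
    using * assms by (intro pd_commute) auto
qed


section \<open>Conformally parametrised null curves of two variables\<close>

text \<open>Local form of the surface: \<open>g\<close> is a lift in a conformal coordinate. Three
  derivatives, because the projection is built from second derivatives and has to be differentiated
  once more.\<close>

locale null_frame =
  fixes U :: "complex set" and g :: "complex \<Rightarrow> 'k::finite minkowski"
  assumes open_U: "open U"
    and smooth: "ck_on 3 U g"
    and null: "z \<in> U \<Longrightarrow> mink (g z) (g z) = 0"
    and nz: "z \<in> U \<Longrightarrow> g z \<noteq> 0"
    and imm: "z \<in> U \<Longrightarrow> pd X g z \<in> span {g z} \<Longrightarrow> X = 0"
    and conf: "z \<in> U \<Longrightarrow>
      mink (pd (\<i> * X) g z) (pd (\<i> * Y) g z) = mink (pd X g z) (pd Y g z)"
begin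

section \<open>The frame and its Gram matrix\<close>

definition "a = pd 1 g"
definition "b = pd \<i> g"
definition "aa = pd 1 a"
definition "ab = pd 1 b"
definition "bb = pd \<i> b"
text \<open>The Laplacian of \<open>g\<close>, four times its mixed complex derivative; it completes
  the frame of the central sphere.\<close>

definition "w z = aa z + bb z"
definition "E z = mink (a z) (a z)"

lemma differentiable [intro, simp]:
  assumes "z \<in> U"
  shows "g differentiable (at z)" "a differentiable (at z)" "b differentiable (at z)"
    "aa differentiable (at z)" "ab differentiable (at z)" "bb differentiable (at z)"
    "w differentiable (at z)"
proof -
  have *: "(\<forall>z\<in>U. g differentiable (at z)) \<and> (\<forall>X. (\<forall>z\<in>U. pd X g differentiable (at z)) \<and>
      (\<forall>Y. (\<forall>z\<in>U. pd Y (pd X g) differentiable (at z))))"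
    using smooth unfolding numeral_3_eq_3 ck_on_Suc_iff[OF open_U] by blast
  then show "g differentiable (at z)" "a differentiable (at z)" "b differentiable (at z)"
    "aa differentiable (at z)" "ab differentiable (at z)" "bb differentiable (at z)"
    using assms unfolding a_def b_def aa_def ab_def bb_def by blast+
  then show "w differentiable (at z)"
    unfolding w_def[abs_def] by (intro differentiable_add)
qed

lemma pd_g: "z \<in> U \<Longrightarrow> pd X g z = Re X *\<^sub>R a z + Im X *\<^sub>R b z"
  unfolding a_def b_def by (rule pd_expand) simp

lemma pd_i_a: "z \<in> U \<Longrightarrow> pd \<i> a z = ab z"
  unfolding a_def ab_def b_def
  using differentiable[unfolded a_def b_def] open_U by (intro pd_commute) auto

lemma mink_const_deriv:
  assumes "\<And>x. x \<in> U \<Longrightarrow> mink (f x) (h x) = c" "z \<in> U"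
    "f differentiable (at z)" "h differentiable (at z)"
  shows "mink (f z) (pd X h z) = - mink (pd X f z) (h z)"
proof -
  have "pd X (\<lambda>x. mink (f x) (h x)) z = pd X (\<lambda>_. c) z"
    using assms open_U by (intro pd_cong) auto
  then show ?thesis using mink.pd[OF assms(3,4), of X] by simp
qed

lemma mink_deriv_cong:
  assumes "\<And>x. x \<in> U \<Longrightarrow> mink (f x) (h x) = mink (f' x) (h' x)" "z \<in> U"
    "f differentiable (at z)" "h differentiable (at z)"
    "f' differentiable (at z)" "h' differentiable (at z)"
  shows "mink (f z) (pd X h z) + mink (pd X f z) (h z)
    = mink (f' z) (pd X h' z) + mink (pd X f' z) (h' z)"
proof -
  have "pd X (\<lambda>x. mink (f x) (h x)) z = pd X (\<lambda>x. mink (f' x) (h' x)) z"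
    using assms open_U by (intro pd_cong) auto
  then show ?thesis using mink.pd[OF assms(3,4), of X] mink.pd[OF assms(5,6), of X] by simp
qed

lemma mink_g_pd: "z \<in> U \<Longrightarrow> mink (g z) (pd X g z) = 0"
  using mink_const_deriv[where f = g and h = g and c = 0 and X = X] null mink_commute[of "g z" "pd X g z"] by simp

lemma gram1 [simp]:
  assumes "z \<in> U"
  shows "mink (g z) (g z) = 0"
    "mink (g z) (a z) = 0" "mink (g z) (b z) = 0" "mink (a z) (g z) = 0" "mink (b z) (g z) = 0"
    "mink (a z) (a z) = E z" "mink (b z) (b z) = E z" "mink (a z) (b z) = 0" "mink (b z) (a z) = 0"
proof -
  show "mink (g z) (g z) = 0" using assms null by simp
  show 1: "mink (g z) (a z) = 0" "mink (g z) (b z) = 0"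
    using mink_g_pd[OF assms] by (simp_all add: a_def b_def)
  then show "mink (a z) (g z) = 0" "mink (b z) (g z) = 0"
    by (simp_all add: mink_commute)
  show "mink (a z) (a z) = E z" by (simp add: E_def)
  show "mink (b z) (b z) = E z" using conf[OF assms, of 1 1] by (simp add: E_def a_def b_def)
  have "pd (- 1) g z = - a z" using pd_g[OF assms, of "- 1"] by simp
  then show "mink (a z) (b z) = 0"
    using conf[OF assms, of 1 \<i>] mink_commute[of "a z" "b z"]
    by (simp add: a_def[symmetric] b_def[symmetric] mink_simps)
  then show "mink (b z) (a z) = 0" by (simp add: mink_commute)
qed

text \<open>The immersion condition keeps \<open>a\<close> off the null line of \<open>g\<close>,
  and a vector orthogonal to a null line but not on it is spacelike.\<close>

lemma E_pos: "z \<in> U \<Longrightarrow> E z > 0"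
  unfolding E_def
  using mink_pos_of_perp_null[of "g z" "a z"] null nz imm[of z 1]
  by (metis a_def gram1(2) zero_neq_one)

lemma E_nz [simp]: "z \<in> U \<Longrightarrow> E z \<noteq> 0"
  using E_pos by fastforce

lemma gram2 [simp]:
  assumes z: "z \<in> U"
  shows "mink (g z) (aa z) = - E z" "mink (g z) (bb z) = - E z" "mink (g z) (ab z) = 0"
    "mink (aa z) (g z) = - E z" "mink (bb z) (g z) = - E z" "mink (ab z) (g z) = 0"
proof -
  show 1: "mink (g z) (aa z) = - E z"
    using mink_const_deriv[OF gram1(2) z differentiable(1,2)[OF z], of 1] z
    by (simp add: aa_def a_def[symmetric])
  show 2: "mink (g z) (bb z) = - E z"
    using mink_const_deriv[OF gram1(3) z differentiable(1,3)[OF z], of \<i>] z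
    by (simp add: bb_def b_def[symmetric])
  show 3: "mink (g z) (ab z) = 0"
    using mink_const_deriv[OF gram1(3) z differentiable(1,3)[OF z], of 1] z
    by (simp add: ab_def a_def[symmetric])
  show "mink (aa z) (g z) = - E z" "mink (bb z) (g z) = - E z" "mink (ab z) (g z) = 0"
    using 1 2 3 mink_commute by metis+
qed

text \<open>These are the derivatives of the conformality relations \<open>(a, a) = (b, b)\<close>
  and \<open>(a, b) = 0\<close>. They make \<open>w\<close> orthogonal to \<open>a\<close> and
  \<open>b\<close>.\<close>

lemma gram3:
  assumes z: "z \<in> U"
  shows "mink (bb z) (a z) = - mink (aa z) (a z)" "mink (ab z) (b z) = mink (aa z) (a z)"
    "mink (aa z) (b z) = - mink (bb z) (b z)" "mink (ab z) (a z) = mink (bb z) (b z)"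
proof -
  note d = differentiable[OF z]
  have eq: "mink (b x) (b x) = mink (a x) (a x)" if "x \<in> U" for x using that by simp
  show 1: "mink (ab z) (b z) = mink (aa z) (a z)"
    using mink_deriv_cong[OF eq z d(3,3,2,2), of 1] mink_commute[of "b z" "ab z"] mink_commute[of "a z" "aa z"]
    by (simp add: ab_def aa_def)
  show 2: "mink (ab z) (a z) = mink (bb z) (b z)"
    using mink_deriv_cong[OF eq z d(3,3,2,2), of \<i>] mink_commute[of "b z" "bb z"] mink_commute[of "a z" "ab z"]
    by (simp add: bb_def pd_i_a z)
  show "mink (aa z) (b z) = - mink (bb z) (b z)"
    using mink_const_deriv[OF gram1(8) z d(2,3), of 1] 2 mink_commute[of "a z" "ab z"]
    by (simp add: ab_def aa_def)
  show "mink (bb z) (a z) = - mink (aa z) (a z)"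
    using mink_const_deriv[OF gram1(8) z d(2,3), of \<i>] 1 mink_commute[of "a z" "bb z"]
    by (simp add: pd_i_a z bb_def)
qed

lemma gram_w [simp]:
  assumes "z \<in> U"
  shows "mink (w z) (g z) = - 2 * E z" "mink (w z) (a z) = 0" "mink (w z) (b z) = 0"
    "mink (g z) (w z) = - 2 * E z" "mink (a z) (w z) = 0" "mink (b z) (w z) = 0"
  using assms gram3[OF assms] mink_commute[of _ "w z"]
  by (auto simp: w_def mink_simps)

section \<open>Orthogonal projection onto the sphere congruence\<close>

definition sphere :: "complex \<Rightarrow> 'k minkowski set" where
  "sphere z = span {g z, a z, b z, w z}"

text \<open>The coefficients are the inverse Gram matrix of the frame: \<open>a\<close> and
  \<open>b\<close> are orthogonal with square \<open>E\<close>, and the block of \<open>g\<close>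
  and \<open>w\<close> has the entries \<open>0\<close>, \<open>- 2 * E\<close> and
  \<open>mink (w z) (w z)\<close>. Differentiability is visible here, unlike in the description that
  defines \<open>proj\<close>.\<close>

definition P :: "complex \<Rightarrow> 'k minkowski_end" where
  "P z = (1 / E z) *\<^sub>R (ten (a z) (a z) + ten (b z) (b z))
     - (1 / (2 * E z)) *\<^sub>R (ten (w z) (g z) + ten (g z) (w z))
     - (mink (w z) (w z) / (4 * (E z * E z))) *\<^sub>R ten (g z) (g z)"

lemma P_apply:
  "P z *v v = (mink v (a z) / E z) *\<^sub>R a z + (mink v (b z) / E z) *\<^sub>R b z
     - (mink v (w z) / (2 * E z)) *\<^sub>R g z - (mink v (g z) / (2 * E z)) *\<^sub>R w z
     - (mink (w z) (w z) * mink v (g z) / (4 * (E z * E z))) *\<^sub>R g z"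
  unfolding P_def
  by (simp add: mvm.add_left mvm.diff_left mvm.scaleR_left ten_apply algebra_simps)

lemma P_sym: "mink (P z *v u) v = mink u (P z *v v)"
  unfolding P_apply mink_simps
  by (simp add: mink_commute[of "a z" v] mink_commute[of "b z" v] mink_commute[of "g z" v]
      mink_commute[of "w z" v] algebra_simps)

lemma P_frame [simp]:
  assumes "z \<in> U"
  shows "P z *v g z = g z" "P z *v a z = a z" "P z *v b z = b z" "P z *v w z = w z"
  using assms by (simp_all add: P_apply)

lemma P_sphere: "z \<in> U \<Longrightarrow> s \<in> sphere z \<Longrightarrow> P z *v s = s"
  using span_minimal[of "{g z, a z, b z, w z}" "{s. P z *v s = s}"]
  by (auto simp: sphere_def subspace_def mvm.add_right mvm.scaleR_right)

lemma P_in_sphere: "P z *v v \<in> sphere z"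
  unfolding P_apply sphere_def
  by (intro span_add span_diff span_scale span_base) auto

lemma P_perp:
  "z \<in> U \<Longrightarrow> s \<in> sphere z \<Longrightarrow> mink (v - P z *v v) s = 0"
  by (simp add: mink_simps P_sym P_sphere)

lemma frame_in_sphere [simp]: "g z \<in> sphere z" "a z \<in> sphere z" "b z \<in> sphere z" "w z \<in> sphere z"
  unfolding sphere_def by (auto intro: span_base)

lemma P_idem: "z \<in> U \<Longrightarrow> P z *v (P z *v v) = P z *v v"
  by (simp add: P_in_sphere P_sphere)

lemma proj_sphere:
  assumes z: "z \<in> U"
  shows "proj (sphere z) v = P z *v v"
  unfolding proj_def
proof (rule the_equality)
  show "P z *v v \<in> sphere z \<and> v - P z *v v \<in> mink_perp (sphere z)"
    using z by (auto simp: P_in_sphere mink_perp_def P_perp)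
next
  fix y assume y: "y \<in> sphere z \<and> v - y \<in> mink_perp (sphere z)"
  \<comment> \<open>\<open>P\<close> reads its argument only through pairings with the frame, so it
    kills \<open>mink_perp (sphere z)\<close>.\<close>
  have "P z *v (v - y) = 0"
    using y by (simp add: P_apply mink_perp_def)
  then show "y = P z *v v"
    using P_sphere[OF z] y by (simp add: mvm.diff_right)
qed

lemma differentiable_E: "z \<in> U \<Longrightarrow> E differentiable (at z)"
  unfolding E_def[abs_def] by (intro mink.differentiable) auto

lemma differentiable_P [intro, simp]:
  assumes z: "z \<in> U"
  shows "P differentiable (at z)"
proof -
  have 1: "(\<lambda>x. 1 / E x) differentiable (at z)"
    "(\<lambda>x. 1 / (2 * E x)) differentiable (at z)"
    "(\<lambda>x. mink (w x) (w x) / (4 * (E x * E x))) differentiable (at z)"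
    using z by (auto intro!: differentiable_divide differentiable_mult mink.differentiable
        differentiable_E)
  show ?thesis
    unfolding P_def[abs_def] using z
    by (intro differentiable_diff differentiable_add differentiable_scaleR ten.differentiable 1)
      auto
qed

section \<open>Derivative of the projection and the tensor \<open>\<N>\<close>\<close>

lemma pd_P:
  assumes z: "z \<in> U"
  shows "pd X P z *v v = P z *v (pd X P z *v v) + pd X P z *v (P z *v v)"
proof -
  have "pd X (\<lambda>x. P x *v v) z = pd X (\<lambda>x. P x *v (P x *v v)) z"
    using z open_U by (intro pd_cong) (auto simp: P_idem)
  moreover have "(\<lambda>x. P x *v v) differentiable (at z)" "pd X (\<lambda>x. P x *v v) z = pd X P z *v v"
    using z mvm.differentiable[of P z "\<lambda>_. v"] mvm.pd[of P z "\<lambda>_. v" X] by (simp_all add: mvm.zero_right)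
  ultimately show ?thesis
    using mvm.pd[of P z "\<lambda>x. P x *v v" X] z by simp
qed

text \<open>Writing \<open>\<D>\<close> with \<open>P\<close> and using the derivative of
  \<open>P P = P\<close> gives \<open>\<D> = d - [dP, P]\<close>, so this commutator is the tensor
  \<open>\<N>\<close>.\<close>

definition N :: "complex \<Rightarrow> complex \<Rightarrow> 'k minkowski_end" where
  "N X z = lie (pd X P z) (P z)"

text \<open>Differentiating \<open>P s = s\<close> shows that \<open>dP\<close> maps
  \<open>s\<close> to the normal part of \<open>ds\<close>, which \<open>P\<close> kills. On
  sections of the sphere bundle \<open>N\<close> is thus the second fundamental form.\<close>

lemma N_section:
  assumes z: "z \<in> U" and s: "s differentiable (at z)" and Ps: "\<And>x. x \<in> U \<Longrightarrow> P x *v s x = s x"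
  shows "N X z *v s z = pd X s z - P z *v pd X s z"
proof -
  have "pd X s z = pd X (\<lambda>x. P x *v s x) z"
    using z Ps open_U by (intro pd_cong) auto
  also have "\<dots> = P z *v pd X s z + pd X P z *v s z"
    using z s by (intro mvm.pd) auto
  finally have *: "pd X P z *v s z = pd X s z - P z *v pd X s z" by (simp add: algebra_simps)
  show ?thesis
    unfolding N_def lie_apply using z by (simp add: Ps * mvm.diff_right P_idem)
qed

text \<open>\<open>P\<close> is symmetric, hence so is its derivative, and a commutator of symmetric
  endomorphisms is skew.\<close>

lemma N_skew:
  assumes z: "z \<in> U"
  shows "mink (N X z *v u) v = - mink u (N X z *v v)"
proof -
  have "mink (pd X P z *v u) v = mink u (pd X P z *v v)" for u v
  proof -
    have d: "(\<lambda>x. P x *v u) differentiable (at z)" for u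
      using z by (intro mvm.differentiable) auto
    have p: "pd X (\<lambda>x. P x *v u) z = pd X P z *v u" for u
      using mvm.pd[of P z "\<lambda>_. u"] z by simp
    show ?thesis
      using mink_deriv_cong[of "\<lambda>x. P x *v u" "\<lambda>_. v" "\<lambda>_. u" "\<lambda>x. P x *v v" z X] d z
      by (simp add: P_sym p mink_simps)
  qed
  then show ?thesis
    by (simp add: N_def lie_apply mink_simps P_sym)
qed

text \<open>First derivatives of \<open>g\<close> stay in \<open>sphere\<close>: the congruence
  envelopes the surface. Hence bracketing with \<open>N\<close> preserves the bivectors with a
  factor \<open>g\<close>.\<close>

lemma N_g [simp]: "z \<in> U \<Longrightarrow> N X z *v g z = 0"
  using N_section[of z g X] by (simp add: pd_g mvm.add_right mvm.scaleR_right)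

text \<open>Since \<open>w = aa + bb\<close> lies in \<open>sphere\<close>, the normal parts of
  \<open>aa\<close> and \<open>bb\<close> are opposite. This singles out the central sphere among
  the enveloping ones and leaves just two normal vectors.\<close>

lemma N_a_b:
  assumes z: "z \<in> U"
  shows "N 1 z *v a z = aa z - P z *v aa z" "N \<i> z *v b z = - (aa z - P z *v aa z)"
    "N 1 z *v b z = ab z - P z *v ab z" "N \<i> z *v a z = ab z - P z *v ab z"
proof -
  show "N 1 z *v a z = aa z - P z *v aa z"
    using N_section[OF z, of a 1] z by (simp add: aa_def)
  show "N 1 z *v b z = ab z - P z *v ab z"
    using N_section[OF z, of b 1] z by (simp add: ab_def)
  show "N \<i> z *v a z = ab z - P z *v ab z"
    using N_section[OF z, of a \<i>] z by (simp add: pd_i_a)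
  have "bb z = w z - aa z" by (simp add: w_def)
  then have "bb z - P z *v bb z = - (aa z - P z *v aa z)"
    using z by (simp add: mvm.diff_right)
  then show "N \<i> z *v b z = - (aa z - P z *v aa z)"
    using N_section[OF z, of b \<i>] z by (simp add: bb_def)
qed

text \<open>The projections to the orthogonal bundle are the real and imaginary parts of the Hopf
  differential, up to constant factors.\<close>

lemma hopf:
  assumes z: "z \<in> U"
  defines "u \<equiv> 2 * mink (aa z) (a z) / E z" and "v \<equiv> 2 * mink (bb z) (b z) / E z"
  obtains s t where
    "aa z - bb z = u *\<^sub>R a z - v *\<^sub>R b z + s *\<^sub>R g z + 2 *\<^sub>R (aa z - P z *v aa z)"
    "2 *\<^sub>R ab z = v *\<^sub>R a z + u *\<^sub>R b z + t *\<^sub>R g z + 2 *\<^sub>R (ab z - P z *v ab z)"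
proof -
  have "\<exists>s. P z *v (aa z - bb z) = u *\<^sub>R a z - v *\<^sub>R b z + s *\<^sub>R g z"
    by (rule exI[of _ "- (mink (aa z - bb z) (w z) / (2 * E z))"])
      (use z in \<open>simp add: P_apply mink_simps gram3 u_def v_def\<close>)
  then obtain s where s: "P z *v (aa z - bb z) = u *\<^sub>R a z - v *\<^sub>R b z + s *\<^sub>R g z" by blast
  have "\<exists>t. P z *v (2 *\<^sub>R ab z) = v *\<^sub>R a z + u *\<^sub>R b z + t *\<^sub>R g z"
    by (rule exI[of _ "- (mink (2 *\<^sub>R ab z) (w z) / (2 * E z))"])
      (use z in \<open>simp add: P_apply mink_simps gram3 u_def v_def\<close>)
  then obtain t where t: "P z *v (2 *\<^sub>R ab z) = v *\<^sub>R a z + u *\<^sub>R b z + t *\<^sub>R g z" by blast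
  have 1: "aa z - bb z = 2 *\<^sub>R aa z - w z" by (simp add: w_def scaleR_2)
  have "aa z - bb z - P z *v (aa z - bb z) = 2 *\<^sub>R (aa z - P z *v aa z)"
    unfolding 1 using z by (simp add: mvm.diff_right mvm.scaleR_right algebra_simps)
  moreover have "2 *\<^sub>R ab z - P z *v (2 *\<^sub>R ab z) = 2 *\<^sub>R (ab z - P z *v ab z)"
    by (simp add: mvm.scaleR_right algebra_simps)
  ultimately show thesis
    using that[of s t] s t by (metis add.commute diff_add_cancel)
qed

text \<open>For \<open>\<eta> = M dx + K dy\<close>: the values of \<open>d \<eta>\<close>, \<open>d *\<eta>\<close>, \<open>[\<N> \<and> \<eta>]\<close> and \<open>[\<N> \<and> *\<eta>]\<close> on
  \<open>(\<partial>\<^sub>x, \<partial>\<^sub>y)\<close>.\<close>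

definition "dform M K z = pd 1 K z - pd \<i> M z"
definition "cod M K z = pd 1 M z + pd \<i> K z"
definition "NW M K z = lie (N 1 z) (K z) - lie (N \<i> z) (M z)"
definition "NC M K z = lie (N 1 z) (M z) + lie (N \<i> z) (K z)"

section \<open>Bivector-valued forms with a factor \<open>g\<close>\<close>

lemma lie_N_wedge: "z \<in> U \<Longrightarrow> lie (N X z) (wedge (g z) t) = wedge (g z) (N X z *v t)"
  by (simp add: lie_wedge_skew N_skew wedge_simps)

lemma pd_wedge_g:
  assumes z: "z \<in> U" and T: "T differentiable (at z)" and M: "\<And>x. x \<in> U \<Longrightarrow> M x = wedge (g x) (T x)"
  shows "pd X M z = wedge (g z) (pd X T z) + wedge (pd X g z) (T z)"
proof -
  have "pd X M z = pd X (\<lambda>x. wedge (g x) (T x)) z"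
    using z M open_U by (intro pd_cong) auto
  then show ?thesis using wedge.pd[of g z T] z T by simp
qed

text \<open>Remove the components along \<open>a\<close> and \<open>b\<close>. The rest
  \<open>m\<close> is itself an admissible \<open>n\<close>, so
  \<open>mink m m = mink t m = 0\<close>, and a null vector orthogonal to \<open>g\<close> is a
  multiple of \<open>g\<close>.\<close>

lemma span_of_perp:
  assumes z: "z \<in> U" and t: "mink (g z) t = 0"
    and n: "\<And>n. mink (g z) n = 0 \<Longrightarrow> mink (a z) n = 0 \<Longrightarrow> mink (b z) n = 0 \<Longrightarrow> mink t n = 0"
  shows "\<exists>r. t = (mink t (a z) / E z) *\<^sub>R a z + (mink t (b z) / E z) *\<^sub>R b z + r *\<^sub>R g z"
proof -
  define m where "m = t - (mink t (a z) / E z) *\<^sub>R a z - (mink t (b z) / E z) *\<^sub>R b z"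
  have m: "mink (g z) m = 0" "mink (a z) m = 0" "mink (b z) m = 0"
    using z t by (simp_all add: m_def mink_simps mink_commute[of _ t])
  have "mink m m = 0"
  proof -
    have "mink m m = mink t m - mink t (a z) / E z * mink (a z) m - mink t (b z) / E z * mink (b z) m"
      by (subst (1) m_def) (simp add: mink_simps)
    then show ?thesis using n[OF m] m by simp
  qed
  then have "m \<in> span {g z}"
    using m z nz by (intro mink_null_perp_null) auto
  then obtain r where "m = r *\<^sub>R g z" by (auto simp: span_singleton)
  then show ?thesis by (intro exI[of _ r]) (simp add: m_def algebra_simps)
qed

text \<open>The terms of the equation without a factor \<open>g\<close> are
  \<open>wedge a T2 - wedge b T1\<close>, so this bivector must have the form
  \<open>wedge g Z\<close>, where \<open>Z\<close> absorbs \<open>c\<close>. Pairing it with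
  \<open>a\<close>, \<open>b\<close> gives the vanishing trace, pairing with \<open>a\<close>,
  \<open>n\<close> and \<open>b\<close>, \<open>n\<close> excludes further components. Symmetry
  follows from \<open>mink g Z = 0\<close> and the derivatives of
  \<open>mink g T1 = mink g T2 = 0\<close>.\<close>

lemma trace_free:
  assumes z: "z \<in> U"
    and T: "T1 differentiable (at z)" "T2 differentiable (at z)"
    and M: "\<And>x. x \<in> U \<Longrightarrow> M x = wedge (g x) (T1 x)" and K: "\<And>x. x \<in> U \<Longrightarrow> K x = wedge (g x) (T2 x)"
    and perp: "\<And>x. x \<in> U \<Longrightarrow> mink (g x) (T1 x) = 0" "\<And>x. x \<in> U \<Longrightarrow> mink (g x) (T2 x) = 0"
    and eq: "dform M K z = c *\<^sub>R NW M K z"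
  defines "\<alpha> \<equiv> mink (T1 z) (a z) / E z" and "\<beta> \<equiv> mink (T1 z) (b z) / E z"
  shows "M z = wedge (g z) (\<alpha> *\<^sub>R a z + \<beta> *\<^sub>R b z)" "K z = wedge (g z) (\<beta> *\<^sub>R a z - \<alpha> *\<^sub>R b z)"
proof -
  define Z where "Z = c *\<^sub>R (N 1 z *v T2 z - N \<i> z *v T1 z) - pd 1 T2 z + pd \<i> T1 z"
  have pdMK: "pd X M z = wedge (g z) (pd X T1 z) + wedge (pd X g z) (T1 z)"
    "pd X K z = wedge (g z) (pd X T2 z) + wedge (pd X g z) (T2 z)" for X
    using pd_wedge_g[OF z T(1)] pd_wedge_g[OF z T(2)] M K by auto
  have Z: "wedge (a z) (T2 z) - wedge (b z) (T1 z) = wedge (g z) Z"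
    using eq z unfolding dform_def NW_def pdMK M[OF z] K[OF z] lie_N_wedge[OF z]
    by (simp add: Z_def wedge_simps a_def b_def algebra_simps)
  have app: "mink v (a z) *\<^sub>R T2 z - mink v (T2 z) *\<^sub>R a z - (mink v (b z) *\<^sub>R T1 z - mink v (T1 z) *\<^sub>R b z)
    = mink v (g z) *\<^sub>R Z - mink v Z *\<^sub>R g z" for v
    using arg_cong[OF Z, of "\<lambda>B. B *v v"] by (simp add: mvm.diff_left wedge_apply)
  have pair: "mink v (a z) * mink (T2 z) y - mink v (T2 z) * mink (a z) y
      - (mink v (b z) * mink (T1 z) y - mink v (T1 z) * mink (b z) y)
    = mink v (g z) * mink Z y - mink v Z * mink (g z) y" for v y
    using arg_cong[OF app, of "\<lambda>u. mink u y" v] by (simp only: mink_simps real_scaleR_def)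
  have gZ: "mink (g z) Z = 0"
  proof -
    have "mink (g z) Z *\<^sub>R g z = 0" using app[of "g z"] z perp by simp
    then show ?thesis using nz z by simp
  qed
  \<comment> \<open>\<open>N\<close> is skew and kills \<open>g\<close>, so its values are
    orthogonal to \<open>g\<close> and drop out of \<open>mink (g z) Z\<close>.\<close>
  have "mink (g z) (N X z *v t) = 0" for X t
    using N_skew[OF z, of X "g z" t] z by (simp add: mink_simps)
  then have "mink (g z) Z = mink (a z) (T2 z) - mink (b z) (T1 z)"
    using mink_const_deriv[OF perp(2) z _ T(2), of 1] mink_const_deriv[OF perp(1) z _ T(1), of \<i>] z
    by (simp add: Z_def mink_simps a_def[symmetric] b_def[symmetric])
  with gZ have symm: "mink (T2 z) (a z) = mink (T1 z) (b z)"
    by (simp add: mink_commute)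
  have "E z * mink (T2 z) (b z) + mink (a z) (T1 z) * E z = 0"
    using pair[of "a z" "b z"] z by simp
  then have "E z * (mink (T2 z) (b z) + mink (T1 z) (a z)) = 0"
    by (simp add: algebra_simps mink_commute)
  then have trace: "mink (T2 z) (b z) = - mink (T1 z) (a z)"
    using z by simp
  have n: "mink (T1 z) n = 0" "mink (T2 z) n = 0"
    if "mink (g z) n = 0" "mink (a z) n = 0" "mink (b z) n = 0" for n
    using pair[of "a z" n] pair[of "b z" n] that z by simp_all
  obtain r1 where r1: "T1 z = \<alpha> *\<^sub>R a z + \<beta> *\<^sub>R b z + r1 *\<^sub>R g z"
    using span_of_perp[OF z perp(1)[OF z] n(1)] unfolding \<alpha>_def \<beta>_def by blast
  obtain r2 where r2: "T2 z = \<beta> *\<^sub>R a z - \<alpha> *\<^sub>R b z + r2 *\<^sub>R g z"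
    using span_of_perp[OF z perp(2)[OF z] n(2)] unfolding \<alpha>_def \<beta>_def symm trace
    by (metis divide_minus_left scaleR_minus_left diff_conv_add_uminus)
  show "M z = wedge (g z) (\<alpha> *\<^sub>R a z + \<beta> *\<^sub>R b z)"
    unfolding M[OF z] r1 by (simp add: wedge_simps)
  show "K z = wedge (g z) (\<beta> *\<^sub>R a z - \<alpha> *\<^sub>R b z)"
    unfolding K[OF z] r2 by (simp add: wedge_simps)
qed

text \<open>\<open>R\<close> and \<open>T\<close> are the Cauchy-Riemann expressions of \<open>E (\<alpha> - \<i> \<beta>)\<close>, divided by \<open>E\<close>.\<close>

lemma cauchy_riemann:
  assumes z: "z \<in> U"
    and d: "\<alpha> differentiable (at z)" "\<beta> differentiable (at z)"
    and M: "\<And>x. x \<in> U \<Longrightarrow> M x = wedge (g x) (\<alpha> x *\<^sub>R a x + \<beta> x *\<^sub>R b x)"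
    and K: "\<And>x. x \<in> U \<Longrightarrow> K x = wedge (g x) (\<beta> x *\<^sub>R a x - \<alpha> x *\<^sub>R b x)"
  obtains R T Y where
    "dform M K z = wedge (g z) (R *\<^sub>R a z - T *\<^sub>R b z) + NW M K z"
    "cod M K z = wedge (g z) (T *\<^sub>R a z + R *\<^sub>R b z) + NC M K z"
    "NW M K z = wedge (g z) Y" "mink (a z) Y = 0" "mink (b z) Y = 0"
proof -
  \<comment> \<open>\<open>u\<close> and \<open>v\<close> are the logarithmic derivatives of
    \<open>E\<close> in the two coordinate directions; they account for the factor \<open>E\<close>
    in \<open>E (\<alpha> - \<i> \<beta>)\<close>.\<close>
  define u where "u = 2 * mink (aa z) (a z) / E z"
  define v where "v = 2 * mink (bb z) (b z) / E z"
  define k1 where "k1 = aa z - P z *v aa z"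
  define k2 where "k2 = ab z - P z *v ab z"
  obtain s t where st: "aa z - bb z = u *\<^sub>R a z - v *\<^sub>R b z + s *\<^sub>R g z + 2 *\<^sub>R k1"
    "2 *\<^sub>R ab z = v *\<^sub>R a z + u *\<^sub>R b z + t *\<^sub>R g z + 2 *\<^sub>R k2"
    using hopf[OF z] unfolding u_def v_def k1_def k2_def by blast
  define T1 where "T1 = (\<lambda>x. \<alpha> x *\<^sub>R a x + \<beta> x *\<^sub>R b x)"
  define T2 where "T2 = (\<lambda>x. \<beta> x *\<^sub>R a x - \<alpha> x *\<^sub>R b x)"
  have dd: "(\<lambda>x. f x *\<^sub>R h x) differentiable (at z)" if "f \<in> {\<alpha>, \<beta>}" "h \<in> {a, b}" for f h
    using that d z by auto
  have dT: "T1 differentiable (at z)" "T2 differentiable (at z)"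
    unfolding T1_def T2_def by (auto intro!: differentiable_add differentiable_diff dd)
  have sc: "pd X (\<lambda>x. f x *\<^sub>R h x) z = f z *\<^sub>R pd X h z + pd X f z *\<^sub>R h z"
    if "f \<in> {\<alpha>, \<beta>}" "h \<in> {a, b}" for f h X
    using bounded_bilinear.pd[OF bounded_bilinear_scaleR, of f z h X] that d z by auto
  have pdT: "pd X T1 z = \<alpha> z *\<^sub>R pd X a z + pd X \<alpha> z *\<^sub>R a z + (\<beta> z *\<^sub>R pd X b z + pd X \<beta> z *\<^sub>R b z)"
    "pd X T2 z = \<beta> z *\<^sub>R pd X a z + pd X \<beta> z *\<^sub>R a z - (\<alpha> z *\<^sub>R pd X b z + pd X \<alpha> z *\<^sub>R b z)" for X
    unfolding T1_def T2_def by (subst pd_add pd_diff, auto intro!: dd simp: sc)+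
  have M': "M x = wedge (g x) (T1 x)" and K': "K x = wedge (g x) (T2 x)" if "x \<in> U" for x
    using M K that by (simp_all add: T1_def T2_def)
  have pdMK: "pd X M z = wedge (g z) (pd X T1 z) + wedge (pd X g z) (T1 z)"
    "pd X K z = wedge (g z) (pd X T2 z) + wedge (pd X g z) (T2 z)" for X
    using pd_wedge_g[OF z dT(1)] pd_wedge_g[OF z dT(2)] M' K' by auto
  define R where "R = pd 1 \<beta> z - pd \<i> \<alpha> z + \<beta> z * u - \<alpha> z * v"
  define T where "T = pd 1 \<alpha> z + pd \<i> \<beta> z + \<beta> z * v + \<alpha> z * u"
  \<comment> \<open>\<open>Y\<close> and \<open>Y'\<close> arise twice: as the normal parts in
    \<open>d \<eta>\<close> and \<open>d *\<eta>\<close>, by \<open>hopf\<close>, and as the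
    coefficients of the brackets with \<open>N\<close>, by \<open>N_a_b\<close>. This agreement is
    what makes the lemma work.\<close>
  define Y where "Y = (2 * \<beta> z) *\<^sub>R k1 - (2 * \<alpha> z) *\<^sub>R k2"
  define Y' where "Y' = (2 * \<alpha> z) *\<^sub>R k1 + (2 * \<beta> z) *\<^sub>R k2"
  have second: "pd 1 a z = aa z" "pd 1 b z = ab z" "pd \<i> a z = ab z" "pd \<i> b z = bb z"
    using z by (simp_all add: aa_def ab_def bb_def pd_i_a)
  have first: "pd 1 g z = a z" "pd \<i> g z = b z" by (simp_all add: a_def b_def)
  have NW: "NW M K z = wedge (g z) Y"
    unfolding NW_def M'[OF z] K'[OF z] lie_N_wedge[OF z] wedge.diff_right[symmetric]
    by (rule arg_cong[of _ _ "wedge (g z)"])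
      (simp add: T1_def T2_def mvm.add_right mvm.diff_right mvm.scaleR_right N_a_b[OF z]
        k1_def[symmetric] k2_def[symmetric] Y_def vec_eq_iff)
  have NC: "NC M K z = wedge (g z) Y'"
    unfolding NC_def M'[OF z] K'[OF z] lie_N_wedge[OF z] wedge.add_right[symmetric]
    by (rule arg_cong[of _ _ "wedge (g z)"])
      (simp add: T1_def T2_def mvm.add_right mvm.diff_right mvm.scaleR_right N_a_b[OF z]
        k1_def[symmetric] k2_def[symmetric] Y'_def vec_eq_iff)
  have "dform M K z = wedge (g z) ((pd 1 \<beta> z - pd \<i> \<alpha> z) *\<^sub>R a z - (pd 1 \<alpha> z + pd \<i> \<beta> z) *\<^sub>R b z
      + \<beta> z *\<^sub>R (aa z - bb z) - \<alpha> z *\<^sub>R (2 *\<^sub>R ab z))"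
    unfolding dform_def pdMK pdT second first
    unfolding T1_def T2_def wedge_simps wedge_self
      wedge_swap[of "b z" "a z"] vec_eq_iff
    by (simp add: algebra_simps)
  also have "\<dots> = wedge (g z) (R *\<^sub>R a z - T *\<^sub>R b z + Y)"
    unfolding st R_def T_def Y_def wedge_simps wedge_self vec_eq_iff by (simp add: algebra_simps)
  finally have 1: "dform M K z = wedge (g z) (R *\<^sub>R a z - T *\<^sub>R b z) + NW M K z"
    unfolding NW by (simp add: wedge_simps)
  have "cod M K z = wedge (g z) ((pd 1 \<alpha> z + pd \<i> \<beta> z) *\<^sub>R a z + (pd 1 \<beta> z - pd \<i> \<alpha> z) *\<^sub>R b z
      + \<alpha> z *\<^sub>R (aa z - bb z) + \<beta> z *\<^sub>R (2 *\<^sub>R ab z))"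
    unfolding cod_def pdMK pdT second first
    unfolding T1_def T2_def wedge_simps wedge_self
      wedge_swap[of "b z" "a z"] vec_eq_iff
    by (simp add: algebra_simps)
  also have "\<dots> = wedge (g z) (T *\<^sub>R a z + R *\<^sub>R b z + Y')"
    unfolding st R_def T_def Y'_def wedge_simps wedge_self vec_eq_iff by (simp add: algebra_simps)
  finally have 2: "cod M K z = wedge (g z) (T *\<^sub>R a z + R *\<^sub>R b z) + NC M K z"
    unfolding NC by (simp add: wedge_simps)
  have "mink k1 s = 0" "mink k2 s = 0" if "s \<in> sphere z" for s
    using P_perp[OF z that] by (simp_all add: k1_def k2_def)
  then have "mink (a z) Y = 0" "mink (b z) Y = 0"
    unfolding Y_def mink_commute[of _ "_ - _"] by (simp_all add: mink_simps)
  with 1 2 NW that show thesis by blast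
qed

text \<open>The relevant cases are \<open>c = 1\<close>, closedness under \<open>\<D>\<close>, and
  \<open>c = 0\<close>, closedness. Changing \<open>c\<close> changes only the normal part of the
  equation, so the Cauchy-Riemann terms vanish either way. For \<open>c = 0\<close> the bracket
  \<open>NW\<close> vanishes too, being equal to \<open>dform\<close>.\<close>

proposition dform_cod_eq:
  assumes z: "z \<in> U"
    and d: "\<And>x. x \<in> U \<Longrightarrow> M differentiable (at x)" "\<And>x. x \<in> U \<Longrightarrow> K differentiable (at x)"
    and M: "\<And>x. x \<in> U \<Longrightarrow> M x \<in> wedge (g x) ` mink_perp {g x}"
    and K: "\<And>x. x \<in> U \<Longrightarrow> K x \<in> wedge (g x) ` mink_perp {g x}"
    and eq: "\<And>x. x \<in> U \<Longrightarrow> dform M K x = c *\<^sub>R NW M K x"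
  shows "dform M K z = NW M K z" "cod M K z = NC M K z"
    "M z \<in> wedge (g z) ` span {g z, a z, b z}" "K z \<in> wedge (g z) ` span {g z, a z, b z}"
proof -
  \<comment> \<open>A differentiable \<open>T\<close> with \<open>M = wedge g T\<close> is needed.
    Applying \<open>M\<close> to a fixed timelike \<open>e\<close> and dividing by
    \<open>mink e g\<close>, which is nonzero on null vectors, recovers \<open>T\<close> up to a
    multiple of \<open>g\<close>.\<close>
  define e :: "'k minkowski" where "e = axis None 1"
  have eg: "mink e (g x) \<noteq> 0" if "x \<in> U" for x
    using mink_eq_0_imp_time_nz[OF null nz] that by (simp add: e_def mink_axis_None)
  define L where "L = (\<lambda>(B :: complex \<Rightarrow> 'k minkowski_end) x. (1 / mink e (g x)) *\<^sub>R (B x *v e))"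
  have dL: "L B differentiable (at x)" if "x \<in> U" "B differentiable (at x)" for B x
    unfolding L_def using that eg
    by (auto intro!: differentiable_scaleR differentiable_divide mink.differentiable mvm.differentiable)
  have L: "mink (g x) (L B x) = 0" "B x = wedge (g x) (L B x)"
    if x: "x \<in> U" and B: "B x \<in> wedge (g x) ` mink_perp {g x}" for B x
  proof -
    obtain t where t: "mink t (g x) = 0" "B x = wedge (g x) t"
      using B by (auto simp: mink_perp_def)
    have "L B x = t - (mink e t / mink e (g x)) *\<^sub>R g x"
      using eg[OF x] by (simp add: L_def t wedge_apply scaleR_diff_right)
    then show "mink (g x) (L B x) = 0" "B x = wedge (g x) (L B x)"
      using t x by (simp_all add: mink_simps mink_commute[of "g x" t] wedge_simps)
  qed
  define \<alpha> where "\<alpha> = (\<lambda>x. mink (L M x) (a x) / E x)"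
  define \<beta> where "\<beta> = (\<lambda>x. mink (L M x) (b x) / E x)"
  have d\<alpha>: "\<alpha> differentiable (at z)" "\<beta> differentiable (at z)"
    unfolding \<alpha>_def \<beta>_def using z d
    by (auto intro!: differentiable_divide mink.differentiable dL differentiable_E)
  have MK: "M x = wedge (g x) (\<alpha> x *\<^sub>R a x + \<beta> x *\<^sub>R b x)" "K x = wedge (g x) (\<beta> x *\<^sub>R a x - \<alpha> x *\<^sub>R b x)"
    if x: "x \<in> U" for x
    using trace_free[where ?T1.0 = "L M" and ?T2.0 = "L K", OF x dL[OF x d(1)[OF x]] dL[OF x d(2)[OF x]] L(2)[OF _ M]
      L(2)[OF _ K] L(1)[OF _ M] L(1)[OF _ K] eq[OF x]]
    unfolding \<alpha>_def \<beta>_def by simp_all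
  obtain R T Y where RT: "dform M K z = wedge (g z) (R *\<^sub>R a z - T *\<^sub>R b z) + NW M K z"
    "cod M K z = wedge (g z) (T *\<^sub>R a z + R *\<^sub>R b z) + NC M K z"
    "NW M K z = wedge (g z) Y" "mink (a z) Y = 0" "mink (b z) Y = 0"
    using cauchy_riemann[OF z d\<alpha> MK] by blast
  have "wedge (g z) (R *\<^sub>R a z - T *\<^sub>R b z + (1 - c) *\<^sub>R Y) = 0"
    using RT(1) eq[OF z] unfolding RT(3) by (simp add: wedge_simps algebra_simps)
  then have "R *\<^sub>R a z - T *\<^sub>R b z + (1 - c) *\<^sub>R Y \<in> span {g z}"
    using nz z by (intro wedge_eq_0_imp_span) auto
  then obtain r where r: "R *\<^sub>R a z - T *\<^sub>R b z + (1 - c) *\<^sub>R Y = r *\<^sub>R g z"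
    by (auto simp: span_singleton)
  \<comment> \<open>\<open>g\<close> and \<open>Y\<close> are orthogonal to \<open>a\<close> and
    \<open>b\<close>, so pairing with \<open>a\<close>, then with \<open>b\<close>, isolates
    \<open>R\<close> and \<open>T\<close>, whose factor \<open>E\<close> is nonzero.\<close>
  have "R = 0"
    using arg_cong[OF r, of "mink (a z)"] z RT(4) by (simp add: mink_simps)
  moreover have "T = 0"
    using arg_cong[OF r, of "mink (b z)"] z RT(5) by (simp add: mink_simps)
  ultimately show "dform M K z = NW M K z" "cod M K z = NC M K z"
    using RT by (simp_all add: wedge_simps)
  show "M z \<in> wedge (g z) ` span {g z, a z, b z}" "K z \<in> wedge (g z) ` span {g z, a z, b z}"
    unfolding MK[OF z]
    by (intro imageI span_add span_diff span_scale; simp add: span_base)+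
qed

end


section \<open>The osculating space of second order\<close>

text \<open>The real counterpart of the span defining \<open>S\<close>. Of the second derivatives
  only the Laplacian enters, so the space is invariant under holomorphic changes of coordinate, not
  under general ones.\<close>

definition osc :: "(complex \<Rightarrow> 'b::real_normed_vector) \<Rightarrow> complex \<Rightarrow> 'b set" where
  "osc f z = span {f z, pd 1 f z, pd \<i> f z, pd 1 (pd 1 f) z + pd \<i> (pd \<i> f) z}"

lemma osc_base:
  "f z \<in> osc f z" "pd 1 f z \<in> osc f z" "pd \<i> f z \<in> osc f z"
  "pd 1 (pd 1 f) z + pd \<i> (pd \<i> f) z \<in> osc f z"
  unfolding osc_def by (auto intro: span_base)

lemma subspace_osc: "subspace (osc f z)"
  by (simp add: osc_def)

lemma osc_subsetI:
  assumes "subspace V" "f z \<in> V" "pd 1 f z \<in> V" "pd \<i> f z \<in> V"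
    "pd 1 (pd 1 f) z + pd \<i> (pd \<i> f) z \<in> V"
  shows "osc f z \<subseteq> V"
  unfolding osc_def using assms by (intro span_minimal) auto

lemma pd_holomorphic:
  assumes "\<phi> holomorphic_on V" "open V" "z \<in> V"
  shows "\<phi> differentiable (at z)" "pd X \<phi> z = deriv \<phi> z * X"
proof -
  have "(\<phi> has_derivative (*) (deriv \<phi> z)) (at z)"
    using holomorphic_derivI[OF assms] by (simp add: has_field_derivative_def)
  then show "\<phi> differentiable (at z)" "pd X \<phi> z = deriv \<phi> z * X"
    by (auto simp: differentiable_def pd_eqI)
qed

text \<open>The Laplacian of \<open>f\<close> composed with \<open>\<phi>\<close> is the Laplacian
  of \<open>f\<close> times the squared modulus of \<open>deriv \<phi>\<close>: the first-order
  terms cancel by the Cauchy-Riemann equations for \<open>deriv \<phi>\<close>, whose real and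
  imaginary parts are \<open>r\<close> and \<open>s\<close>.\<close>

lemma osc_compose:
  assumes U: "open U" "ck_on 2 U f" and V: "open V" "z \<in> V" and hol: "\<phi> holomorphic_on V"
    and im: "\<And>x. x \<in> V \<Longrightarrow> \<phi> x \<in> U"
  shows "osc (\<lambda>x. f (\<phi> x)) z \<subseteq> osc f (\<phi> z)"
proof -
  note d = ck_on_2D(1,2)[OF U im]
  note \<phi> = pd_holomorphic[OF hol V(1)]
  note \<phi>' = pd_holomorphic[OF holomorphic_deriv[OF hol V(1)] V(1)]
  define r where "r = (\<lambda>x. Re (deriv \<phi> x))"
  define s where "s = (\<lambda>x. Im (deriv \<phi> x))"
  define a where "a = pd 1 f"
  define b where "b = pd \<i> f"
  have chain: "pd X (\<lambda>x. h (\<phi> x)) x = Re (deriv \<phi> x * X) *\<^sub>R pd 1 h (\<phi> x) + Im (deriv \<phi> x * X) *\<^sub>R pd \<i> h (\<phi> x)"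
    and dchain: "(\<lambda>x. h (\<phi> x)) differentiable (at x)"
    if "x \<in> V" "h differentiable (at (\<phi> x))" for h :: "complex \<Rightarrow> 'a" and x X
  proof -
    show "(\<lambda>x. h (\<phi> x)) differentiable (at x)"
      using \<phi>(1)[OF that(1)] that(2) differentiable_chain_at[of \<phi> x h] by (simp add: o_def)
    show "pd X (\<lambda>x. h (\<phi> x)) x = Re (deriv \<phi> x * X) *\<^sub>R pd 1 h (\<phi> x) + Im (deriv \<phi> x * X) *\<^sub>R pd \<i> h (\<phi> x)"
      using pd_compose[OF \<phi>(1)[OF that(1)] that(2)] pd_expand[OF that(2), of "deriv \<phi> x * X"]
      by (simp add: \<phi>(2)[OF that(1)])
  qed
  have 1: "pd 1 (\<lambda>x. f (\<phi> x)) x = r x *\<^sub>R a (\<phi> x) + s x *\<^sub>R b (\<phi> x)"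
    "pd \<i> (\<lambda>x. f (\<phi> x)) x = r x *\<^sub>R b (\<phi> x) - s x *\<^sub>R a (\<phi> x)" if "x \<in> V" for x
    using chain[OF that d(1)[OF that]] by (simp_all add: r_def s_def a_def b_def)
  have dab: "a differentiable (at (\<phi> z))" "b differentiable (at (\<phi> z))"
    unfolding a_def b_def using d(2)[OF V(2)] by auto
  have drs: "r differentiable (at z)" "s differentiable (at z)"
    unfolding r_def s_def
    by (rule bounded_linear.differentiable[OF bounded_linear_Re \<phi>'(1)[OF V(2)]]
        bounded_linear.differentiable[OF bounded_linear_Im \<phi>'(1)[OF V(2)]])+
  have pdrs: "pd X r z = Re (deriv (deriv \<phi>) z * X)" "pd X s z = Im (deriv (deriv \<phi>) z * X)" for X
    unfolding r_def s_def using \<phi>'[OF V(2)]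
    by (simp_all add: bounded_linear.pd[OF bounded_linear_Re] bounded_linear.pd[OF bounded_linear_Im])
  have ds: "(\<lambda>x. k x *\<^sub>R h (\<phi> x)) differentiable (at z)"
    and ps: "pd X (\<lambda>x. k x *\<^sub>R h (\<phi> x)) z = k z *\<^sub>R pd X (\<lambda>x. h (\<phi> x)) z + pd X k z *\<^sub>R h (\<phi> z)"
    if "k \<in> {r, s}" "h \<in> {a, b}" for k h X
  proof -
    have *: "k differentiable (at z)" "(\<lambda>x. h (\<phi> x)) differentiable (at z)"
      using that drs dab dchain V(2) by auto
    then show "(\<lambda>x. k x *\<^sub>R h (\<phi> x)) differentiable (at z)" by (rule differentiable_scaleR)
    show "pd X (\<lambda>x. k x *\<^sub>R h (\<phi> x)) z = k z *\<^sub>R pd X (\<lambda>x. h (\<phi> x)) z + pd X k z *\<^sub>R h (\<phi> z)"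
      using bounded_bilinear.pd[OF bounded_bilinear_scaleR *] .
  qed
  have p1: "pd 1 (pd 1 (\<lambda>x. f (\<phi> x))) z = pd 1 (\<lambda>x. r x *\<^sub>R a (\<phi> x) + s x *\<^sub>R b (\<phi> x)) z"
    using V 1 by (intro pd_cong) auto
  have p2: "pd \<i> (pd \<i> (\<lambda>x. f (\<phi> x))) z = pd \<i> (\<lambda>x. r x *\<^sub>R b (\<phi> x) - s x *\<^sub>R a (\<phi> x)) z"
    using V 1 by (intro pd_cong) auto
  have comm: "pd \<i> a (\<phi> z) = pd 1 b (\<phi> z)"
    unfolding a_def b_def using ck_on_2D(3)[OF U im[OF V(2)]] .
  have pa: "pd 1 (\<lambda>x. a (\<phi> x)) z = r z *\<^sub>R pd 1 a (\<phi> z) + s z *\<^sub>R pd 1 b (\<phi> z)"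
    "pd \<i> (\<lambda>x. a (\<phi> x)) z = r z *\<^sub>R pd 1 b (\<phi> z) - s z *\<^sub>R pd 1 a (\<phi> z)"
    "pd 1 (\<lambda>x. b (\<phi> x)) z = r z *\<^sub>R pd 1 b (\<phi> z) + s z *\<^sub>R pd \<i> b (\<phi> z)"
    "pd \<i> (\<lambda>x. b (\<phi> x)) z = r z *\<^sub>R pd \<i> b (\<phi> z) - s z *\<^sub>R pd 1 b (\<phi> z)"
    using chain[OF V(2) dab(1)] chain[OF V(2) dab(2)] by (simp_all add: r_def s_def comm)
  have q1: "pd 1 (pd 1 (\<lambda>x. f (\<phi> x))) z = r z *\<^sub>R pd 1 (\<lambda>x. a (\<phi> x)) z + pd 1 r z *\<^sub>R a (\<phi> z)
      + (s z *\<^sub>R pd 1 (\<lambda>x. b (\<phi> x)) z + pd 1 s z *\<^sub>R b (\<phi> z))"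
    unfolding p1 by (subst pd_add) (auto intro: ds simp: ps)
  have q2: "pd \<i> (pd \<i> (\<lambda>x. f (\<phi> x))) z = r z *\<^sub>R pd \<i> (\<lambda>x. b (\<phi> x)) z + pd \<i> r z *\<^sub>R b (\<phi> z)
      - (s z *\<^sub>R pd \<i> (\<lambda>x. a (\<phi> x)) z + pd \<i> s z *\<^sub>R a (\<phi> z))"
    unfolding p2 by (subst pd_diff) (auto intro: ds simp: ps)
  have lap: "pd 1 (pd 1 (\<lambda>x. f (\<phi> x))) z + pd \<i> (pd \<i> (\<lambda>x. f (\<phi> x))) z
      = (r z * r z + s z * s z) *\<^sub>R (pd 1 a (\<phi> z) + pd \<i> b (\<phi> z))"
    unfolding q1 q2 pa pdrs by (simp add: algebra_simps)
  have mem: "a (\<phi> z) \<in> osc f (\<phi> z)" "b (\<phi> z) \<in> osc f (\<phi> z)"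
    "pd 1 a (\<phi> z) + pd \<i> b (\<phi> z) \<in> osc f (\<phi> z)"
    unfolding a_def b_def by (rule osc_base)+
  show ?thesis
    by (rule osc_subsetI[OF subspace_osc]; (unfold lap 1[OF V(2)])?)
      (intro subspace_add subspace_diff subspace_scale subspace_osc mem osc_base)+
qed

lemma subspace_scale_cancel:
  fixes v :: "'b::real_vector"
  assumes "subspace V" "r *\<^sub>R v \<in> V" "r \<noteq> 0"
  shows "v \<in> V"
  using subspace_scale[OF assms(1,2), of "inverse r"] assms(3) by simp

text \<open>\<open>h\<close> is a multiple of \<open>f\<close>, expressed by cross-multiplication so
  that no quotient has to be differentiated. Differentiating the relation and cancelling the
  coordinate of \<open>f\<close> puts the derivatives of \<open>h\<close> into the span.\<close>

lemma osc_scale: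
  fixes f h :: "complex \<Rightarrow> real ^ 'v::finite"
  assumes U: "open U" "z \<in> U" and f: "ck_on 2 U f" and h: "ck_on 2 U h"
    and eq: "\<And>x. x \<in> U \<Longrightarrow> f x $ i *\<^sub>R h x = h x $ i *\<^sub>R f x" and nz: "f z $ i \<noteq> 0"
  shows "osc h z \<subseteq> osc f z"
proof -
  note df = ck_on_2D(1,2)[OF U(1) f] and dh = ck_on_2D(1,2)[OF U(1) h]
  have dc: "(\<lambda>x. k x $ i) differentiable (at x)" "pd X (\<lambda>x. k x $ i) x = pd X k x $ i"
    if "k differentiable (at x)" for k :: "complex \<Rightarrow> real ^ 'v" and x X
    using bounded_linear.differentiable[OF bounded_linear_vec_nth that]
      bounded_linear.pd[OF bounded_linear_vec_nth that] by auto
  have prod: "(\<lambda>x. k x $ i *\<^sub>R l x) differentiable (at x)"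
    "pd X (\<lambda>x. k x $ i *\<^sub>R l x) x = k x $ i *\<^sub>R pd X l x + pd X k x $ i *\<^sub>R l x"
    if "k differentiable (at x)" "l differentiable (at x)" for k l :: "complex \<Rightarrow> real ^ 'v" and x X
    using bounded_bilinear.differentiable[OF bounded_bilinear_scaleR dc(1)[OF that(1)] that(2)]
      bounded_bilinear.pd[OF bounded_bilinear_scaleR dc(1)[OF that(1)] that(2)]
    by (simp_all add: dc[OF that(1)])
  have first: "f x $ i *\<^sub>R pd X h x + pd X f x $ i *\<^sub>R h x = h x $ i *\<^sub>R pd X f x + pd X h x $ i *\<^sub>R f x"
    if "x \<in> U" for x X
  proof -
    have "pd X (\<lambda>x. f x $ i *\<^sub>R h x) x = pd X (\<lambda>x. h x $ i *\<^sub>R f x) x"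
      using U that eq by (intro pd_cong) auto
    then show ?thesis using prod df dh that by simp
  qed
  have second: "f z $ i *\<^sub>R pd X (pd X h) z + 2 *\<^sub>R (pd X f z $ i *\<^sub>R pd X h z) + pd X (pd X f) z $ i *\<^sub>R h z
    = h z $ i *\<^sub>R pd X (pd X f) z + 2 *\<^sub>R (pd X h z $ i *\<^sub>R pd X f z) + pd X (pd X h) z $ i *\<^sub>R f z" for X
  proof -
    have "pd X (\<lambda>x. f x $ i *\<^sub>R pd X h x + pd X f x $ i *\<^sub>R h x) z
      = pd X (\<lambda>x. h x $ i *\<^sub>R pd X f x + pd X h x $ i *\<^sub>R f x) z"
      using U first by (intro pd_cong) auto
    then have "f z $ i *\<^sub>R pd X (pd X h) z + pd X f z $ i *\<^sub>R pd X h z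
        + (pd X f z $ i *\<^sub>R pd X h z + pd X (pd X f) z $ i *\<^sub>R h z)
      = h z $ i *\<^sub>R pd X (pd X f) z + pd X h z $ i *\<^sub>R pd X f z
        + (pd X h z $ i *\<^sub>R pd X f z + pd X (pd X h) z $ i *\<^sub>R f z)"
      using prod df[OF U(2)] dh[OF U(2)] by (simp add: pd_add)
    then show ?thesis
      unfolding vec_eq_iff by (simp add: algebra_simps)
  qed
  have 0: "h z \<in> osc f z"
  proof (rule subspace_scale_cancel[OF subspace_osc _ nz])
    show "f z $ i *\<^sub>R h z \<in> osc f z"
      unfolding eq[OF U(2)] by (intro subspace_scale subspace_osc osc_base)
  qed
  have 1: "pd X h z \<in> osc f z" if "X \<in> {1, \<i>}" for X
  proof (rule subspace_scale_cancel[OF subspace_osc _ nz])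
    have "f z $ i *\<^sub>R pd X h z = h z $ i *\<^sub>R pd X f z + pd X h z $ i *\<^sub>R f z - pd X f z $ i *\<^sub>R h z"
      using first[OF U(2), of X] by (simp add: algebra_simps)
    also have "\<dots> \<in> osc f z"
      using that 0 by (auto intro!: subspace_add subspace_diff subspace_scale subspace_osc osc_base)
    finally show "f z $ i *\<^sub>R pd X h z \<in> osc f z" .
  qed
  have 2: "pd 1 (pd 1 h) z + pd \<i> (pd \<i> h) z \<in> osc f z"
  proof (rule subspace_scale_cancel[OF subspace_osc _ nz])
    \<comment> \<open>\<open>D X\<close> collects the terms already known to lie in
      \<open>osc f z\<close>. A single pure second derivative of \<open>f\<close> need not lie
      there, so the directions \<open>1\<close> and \<open>\<i>\<close> must be added before
      concluding.\<close>
    define D where "D = (\<lambda>X. 2 *\<^sub>R (pd X h z $ i *\<^sub>R pd X f z) + pd X (pd X h) z $ i *\<^sub>R f z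
      - 2 *\<^sub>R (pd X f z $ i *\<^sub>R pd X h z) - pd X (pd X f) z $ i *\<^sub>R h z)"
    have s: "f z $ i *\<^sub>R pd X (pd X h) z = h z $ i *\<^sub>R pd X (pd X f) z + D X" for X
      using second[of X] by (simp add: D_def algebra_simps)
    have D: "D X \<in> osc f z" if "X \<in> {1, \<i>}" for X
      unfolding D_def using that 0 1[OF that]
      by (auto intro!: subspace_add subspace_diff subspace_scale subspace_osc osc_base)
    have "f z $ i *\<^sub>R (pd 1 (pd 1 h) z + pd \<i> (pd \<i> h) z)
      = h z $ i *\<^sub>R (pd 1 (pd 1 f) z + pd \<i> (pd \<i> f) z) + D 1 + D \<i>"
      unfolding scaleR_add_right s by (simp add: algebra_simps)
    also have "\<dots> \<in> osc f z"
      by (intro subspace_add subspace_scale subspace_osc osc_base D) auto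
    finally show "f z $ i *\<^sub>R (pd 1 (pd 1 h) z + pd \<i> (pd \<i> h) z) \<in> osc f z" .
  qed
  show ?thesis using 0 1 2 by (intro osc_subsetI subspace_osc) auto
qed

lemma ck_on_subset:
  assumes "open U" "open V" "V \<subseteq> U"
  shows "ck_on k U f \<Longrightarrow> ck_on k V f"
proof (induction k arbitrary: f)
  case 0
  then show ?case using assms continuous_on_subset by auto
next
  case (Suc k)
  then show ?case using assms unfolding ck_on_Suc_iff[OF assms(1)] ck_on_Suc_iff[OF assms(2)] by blast
qed


section \<open>Complexification\<close>

lemma complexify_simps:
  "complexify (v + w) = complexify v + complexify w"
  "complexify (r *\<^sub>R v) = r *\<^sub>R complexify v"
  "complex_of_real r *s complexify v = complexify (r *\<^sub>R v)"
  by (simp_all add: complexify_def vec_eq_iff complex_eq_iff)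

lemma bounded_linear_complexify: "bounded_linear complexify"
  by (intro linear_conv_bounded_linear[THEN iffD1] linearI) (simp_all add: complexify_simps)

lemma bounded_linear_vector_scalar_mult: "bounded_linear (\<lambda>v :: complex ^ 'v::finite. k *s v)"
  by (intro linear_conv_bounded_linear[THEN iffD1] linearI)
    (simp_all add: vec_eq_iff algebra_simps)

text \<open>Taking real and imaginary parts of coordinates maps the complex span into the real one;
  conversely the complexified \<open>a\<close> and \<open>b\<close> are \<open>s + t\<close> and
  \<open>\<i> *s (s - t)\<close>. The factor 1/4 relates the mixed complex derivative to the
  Laplacian.\<close>

lemma complexify_mem_span_iff:
  fixes a b u w :: "'k::finite minkowski"
  defines "s \<equiv> (1/2) *s (complexify a - \<i> *s complexify b)"
    and "t \<equiv> (1/2) *s (complexify a + \<i> *s complexify b)"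
  shows "complexify v \<in> vec.span {complexify u, s, t, (1/4) *s complexify w}
    \<longleftrightarrow> v \<in> span {u, a, b, w}"
    (is "_ \<in> vec.span ?B \<longleftrightarrow> _")
proof
  define S where "S = span {u, a, b, w}"
  define re :: "complex ^ 'k option \<Rightarrow> 'k minkowski" where "re = (\<lambda>x. \<chi> i. Re (x $ i))"
  define im :: "complex ^ 'k option \<Rightarrow> 'k minkowski" where "im = (\<lambda>x. \<chi> i. Im (x $ i))"
  have re_simps: "re (x + y) = re x + re y" "re (k *s x) = Re k *\<^sub>R re x - Im k *\<^sub>R im x"
    "re (x - y) = re x - re y" "im (x - y) = im x - im y"
    "im (x + y) = im x + im y" "im (k *s x) = Re k *\<^sub>R im x + Im k *\<^sub>R re x"
    "re 0 = 0" "im 0 = 0" "re (complexify v) = v" "im (complexify v) = 0" for x y k v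
    by (simp_all add: re_def im_def vec_eq_iff complexify_def)
  have S: "subspace S" "u \<in> S" "a \<in> S" "b \<in> S" "w \<in> S"
    unfolding S_def by (auto intro: span_base)
  have "vec.subspace {x. re x \<in> S \<and> im x \<in> S}"
    unfolding vec.subspace_def using S(1)
    by (auto simp: re_simps intro!: subspace_add subspace_diff subspace_scale subspace_0)
  moreover have "?B \<subseteq> {x. re x \<in> S \<and> im x \<in> S}"
    using S by (auto simp: re_simps s_def t_def subspace_0 intro!: subspace_neg subspace_scale)
  ultimately have "vec.span ?B \<subseteq> {x. re x \<in> S \<and> im x \<in> S}"
    by (intro vec.span_minimal)
  moreover assume "complexify v \<in> vec.span ?B"
  ultimately show "v \<in> span {u, a, b, w}"
    unfolding S_def[symmetric] by (auto simp: re_simps)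
next
  have "subspace {v. complexify v \<in> vec.span ?B}"
    unfolding subspace_def
    by (auto simp: complexify_simps linear_0[OF bounded_linear.linear[OF bounded_linear_complexify]] vec.span_zero intro: vec.span_add)
      (metis complexify_simps(2,3) vec.span_scale)
  moreover have "{u, a, b, w} \<subseteq> {v. complexify v \<in> vec.span ?B}"
  proof -
    have "complexify a = s + t"
      by (simp add: s_def t_def vec_eq_iff field_simps)
    moreover have "complexify b = \<i> *s (s - t)"
      by (simp add: s_def t_def vec_eq_iff field_simps)
    moreover have "complexify w = 4 *s ((1/4) *s complexify w)"
      by (simp add: vec_eq_iff)
    moreover have "s \<in> vec.span ?B" "t \<in> vec.span ?B" "(1/4) *s complexify w \<in> vec.span ?B"
      "complexify u \<in> vec.span ?B"
      by (auto intro: vec.span_base)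
    ultimately show ?thesis
      by (metis (no_types, lifting) insert_subset mem_Collect_eq empty_subsetI vec.span_add
          vec.span_diff vec.span_scale)
  qed
  ultimately have "span {u, a, b, w} \<subseteq> {v. complexify v \<in> vec.span ?B}"
    by (intro span_minimal)
  then show "v \<in> span {u, a, b, w} \<Longrightarrow> complexify v \<in> vec.span ?B" by blast
qed


section \<open>Surfaces in charts\<close>

lemma riemann_surfaceD:
  assumes "riemann_surface A" "c \<in> A"
  shows "open (fst c)" "open (snd c ` fst c)" "homeomorphism (fst c) (snd c ` fst c) (snd c) (chart_inv c)"
    "c' \<in> A \<Longrightarrow> transition c c' holomorphic_on snd c ` (fst c \<inter> fst c')"
  using assms unfolding riemann_surface_def by auto

lemma open_chart_image:
  assumes "riemann_surface A" "c \<in> A" "open W"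
  shows "open (snd c ` (fst c \<inter> W))"
proof -
  note c = riemann_surfaceD[OF assms(1,2)]
  have "openin (top_of_set (snd c ` fst c)) (snd c ` (fst c \<inter> W))"
    using assms(3) by (intro homeomorphism_imp_open_map[OF c(3)] openin_open_Int)
  then show ?thesis using openin_open_eq[OF c(2)] by blast
qed

lemma chart_inv_chart:
  assumes "riemann_surface A" "c \<in> A" "x \<in> fst c"
  shows "chart_inv c (snd c x) = x"
  using riemann_surfaceD(3)[OF assms(1,2)] assms(3) homeomorphism_apply1 by blast

lemma chart_chart_inv:
  assumes "riemann_surface A" "c \<in> A" "z \<in> snd c ` (fst c \<inter> W)"
  shows "chart_inv c z \<in> fst c" "chart_inv c z \<in> W" "snd c (chart_inv c z) = z"
  using assms chart_inv_chart[OF assms(1,2)] by auto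

lemma dd_conv_pd: "dd c f x X = pd X (f \<circ> chart_inv c) (snd c x)"
  by (simp add: dd_def pd_def)

lemma one_formD:
  assumes "one_form A \<mu>"
  shows "\<forall>c\<in>A. \<forall>p\<in>fst c. linear (\<mu> c p)"
    and "\<forall>c\<in>A. \<forall>X. smooth_on A (fst c) (\<lambda>p. \<mu> c p X)"
    and "\<forall>c\<in>A. \<forall>c'\<in>A. \<forall>p\<in>fst c \<inter> fst c'. \<forall>X.
      \<mu> c p X = \<mu> c' p (deriv (transition c c') (snd c p) * X)"
    and "\<forall>c p X. c \<notin> A \<or> p \<notin> fst c \<longrightarrow> \<mu> c p X = 0"
  using assms unfolding one_form_def by - (elim conjE, assumption)+

lemma one_form_ck_on:
  assumes "one_form A \<mu>" "c \<in> A" "c' \<in> A"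
  shows "ck_on k (snd c' ` (fst c' \<inter> fst c)) ((\<lambda>p. \<mu> c p X) \<circ> chart_inv c')"
  using one_formD(2)[OF assms(1)] assms(2,3) unfolding smooth_on_def by blast

lemma one_form_differentiable:
  assumes "riemann_surface A" "one_form A \<mu>" "c \<in> A" "z \<in> snd c ` fst c"
  shows "(\<lambda>y. \<mu> c (chart_inv c y) X) differentiable (at z)"
proof -
  have "ck_on 1 (snd c ` fst c) ((\<lambda>x. \<mu> c x X) \<circ> chart_inv c)"
    using one_form_ck_on[OF assms(2,3,3)] by simp
  then show ?thesis
    using ck_on_1D[OF riemann_surfaceD(2)[OF assms(1,3)] _ assms(4)] by (simp add: o_def)
qed

lemma one_form_outside: "one_form A \<mu> \<Longrightarrow> c \<notin> A \<or> p \<notin> fst c \<Longrightarrow> \<mu> c p X = 0"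
  by (rule one_formD(4)[rule_format])

lemma one_form_linear: "one_form A \<mu> \<Longrightarrow> c \<in> A \<Longrightarrow> x \<in> fst c \<Longrightarrow> linear (\<mu> c x)"
  by (rule one_formD(1)[rule_format])

lemma one_form_star:
  assumes "riemann_surface A" "one_form A \<mu>"
  shows "one_form A (star \<mu>)"
  unfolding one_form_def
proof (intro conjI ballI allI impI)
  fix c X assume c: "c \<in> A"
  show "smooth_on A (fst c) (\<lambda>p. star \<mu> c p X)"
    unfolding smooth_on_def
  proof (intro ballI allI)
    fix c' k assume c': "c' \<in> A"
    have "ck_on k (snd c' ` (fst c' \<inter> fst c)) ((\<lambda>p. \<mu> c p (\<i> * X)) \<circ> chart_inv c')"
      by (rule one_form_ck_on[OF assms(2) c c'])
    from ck_on_minus[OF open_chart_image[OF assms(1) c' riemann_surfaceD(1)[OF assms(1) c]] this]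
    show "ck_on k (snd c' ` (fst c' \<inter> fst c)) ((\<lambda>p. star \<mu> c p X) \<circ> chart_inv c')"
      by (simp add: star_def o_def)
  qed
next
  fix c p assume "c \<in> A" "p \<in> fst c"
  then have "linear (\<mu> c p)" by (rule one_form_linear[OF assms(2)])
  then show "linear (star \<mu> c p)"
    by (auto intro!: linearI simp: star_def linear_add distrib_left linear_scale)
next
  fix c c' p X assume "c \<in> A" "c' \<in> A" "p \<in> fst c \<inter> fst c'"
  then have "\<mu> c p (\<i> * X) = \<mu> c' p (deriv (transition c c') (snd c p) * (\<i> * X))"
    by (rule one_formD(3)[OF assms(2), rule_format])
  then show "star \<mu> c p X = star \<mu> c' p (deriv (transition c c') (snd c p) * X)"
    by (simp add: star_def mult.left_commute)
next
  fix c p X assume "c \<notin> A \<or> p \<notin> fst c"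
  then show "star \<mu> c p X = 0"
    using one_form_outside[OF assms(2)] by (simp add: star_def)
qed

lemma one_form_add:
  assumes "riemann_surface A" "one_form A \<mu>" "one_form A \<eta>"
  shows "one_form A (\<lambda>c p X. \<mu> c p X + \<eta> c p X)"
  unfolding one_form_def
proof (intro conjI ballI allI impI)
  fix c X assume c: "c \<in> A"
  show "smooth_on A (fst c) (\<lambda>p. \<mu> c p X + \<eta> c p X)"
    unfolding smooth_on_def
  proof (intro ballI allI)
    fix c' k assume c': "c' \<in> A"
    have "ck_on k (snd c' ` (fst c' \<inter> fst c)) ((\<lambda>p. \<mu> c p X) \<circ> chart_inv c')"
      "ck_on k (snd c' ` (fst c' \<inter> fst c)) ((\<lambda>p. \<eta> c p X) \<circ> chart_inv c')"
      by (rule one_form_ck_on[OF assms(2) c c'] one_form_ck_on[OF assms(3) c c'])+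
    from ck_on_add[OF open_chart_image[OF assms(1) c' riemann_surfaceD(1)[OF assms(1) c]] this]
    show "ck_on k (snd c' ` (fst c' \<inter> fst c)) ((\<lambda>p. \<mu> c p X + \<eta> c p X) \<circ> chart_inv c')"
      by (simp add: o_def)
  qed
next
  fix c p assume "c \<in> A" "p \<in> fst c"
  then have "linear (\<mu> c p)" "linear (\<eta> c p)" by (simp_all add: one_form_linear[OF assms(2)] one_form_linear[OF assms(3)])
  then show "linear (\<lambda>X. \<mu> c p X + \<eta> c p X)"
    by (rule linear_compose_add)
next
  fix c c' p X assume "c \<in> A" "c' \<in> A" "p \<in> fst c \<inter> fst c'"
  then show "\<mu> c p X + \<eta> c p X = \<mu> c' p (deriv (transition c c') (snd c p) * X)
      + \<eta> c' p (deriv (transition c c') (snd c p) * X)"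
    by (intro arg_cong2[of _ _ _ _ "(+)"] one_formD(3)[OF assms(2), rule_format]
        one_formD(3)[OF assms(3), rule_format])
next
  fix c p X assume "c \<notin> A \<or> p \<notin> fst c"
  then show "\<mu> c p X + \<eta> c p X = 0"
    using one_form_outside[OF assms(2)] one_form_outside[OF assms(3)] by simp
qed

lemma star_star:
  assumes "one_form A \<mu>"
  shows "star (star \<mu>) c p X = - \<mu> c p X"
\<comment> \<open>Forms are compared as functions, so the identity is also needed outside the atlas,
  where both sides are 0 by convention.\<close>
proof (cases "c \<in> A \<and> p \<in> fst c")
  case True
  then show ?thesis
    using linear_neg[OF one_form_linear[OF assms], of c p X] by (simp add: star_def mult.assoc[symmetric])
next
  case False
  then show ?thesis using one_form_outside[OF assms, of c p] by (simp add: star_def)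
qed

text \<open>The double star is negation, so the difference is a sum with
  \<open>star (star \<eta>)\<close>.\<close>

lemma one_form_diff:
  assumes "riemann_surface A" "one_form A \<mu>" "one_form A \<eta>"
  shows "one_form A (\<lambda>c p X. \<mu> c p X - \<eta> c p X)"
  using one_form_add[OF assms(1,2) one_form_star[OF assms(1) one_form_star[OF assms(1,3)]]]
  by (simp add: star_star[OF assms(3)])

lemma section_line:
  assumes "null_line_bundle A \<Lambda>" "\<sigma> \<in> sections A \<Lambda> W" "x \<in> W"
  shows "\<Lambda> x = span {\<sigma> x}" "mink (\<sigma> x) (\<sigma> x) = 0" "\<sigma> x \<noteq> 0"
proof -
  obtain v where v: "v \<noteq> 0" "mink v v = 0" "\<Lambda> x = span {v}"
    using assms(1) unfolding null_line_bundle_def by blast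
  have s: "\<sigma> x \<in> \<Lambda> x" "\<sigma> x \<noteq> 0" using assms(2,3) unfolding sections_def by auto
  then obtain k where k: "\<sigma> x = k *\<^sub>R v" "k \<noteq> 0" using v by (auto simp: span_singleton)
  show "\<sigma> x \<noteq> 0" by fact
  show "mink (\<sigma> x) (\<sigma> x) = 0" using k v by (simp add: mink_simps)
  have "v = (1 / k) *\<^sub>R \<sigma> x" using k by simp
  then have "v \<in> span {\<sigma> x}" by (metis span_base span_scale singletonI)
  then show "\<Lambda> x = span {\<sigma> x}"
    unfolding v(3) using s v(3) by (intro subset_antisym span_minimal) auto
qed

lemma section_ck_on:
  assumes "\<sigma> \<in> sections A \<Lambda> W" "c \<in> A"
  shows "ck_on k (snd c ` (fst c \<inter> W)) (\<sigma> \<circ> chart_inv c)"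
  using assms unfolding sections_def smooth_on_def by blast

lemma central_sphere_chart:
  fixes \<Lambda> :: "'m::{t2_space,second_countable_topology} \<Rightarrow> 'k::finite minkowski set"
  assumes A: "riemann_surface A" and c: "c \<in> A" "x \<in> fst c"
    and \<sigma>: "\<sigma> \<in> sections A \<Lambda> W" "open W" "x \<in> W"
  defines "s \<equiv> complexify \<circ> \<sigma>"
  shows "complexify v \<in> vec.span {s x, d_z c s x, d_zbar c s x, d_zbar c (d_z c s) x}
    \<longleftrightarrow> v \<in> osc (\<sigma> \<circ> chart_inv c) (snd c x)"
proof -
  define f where "f = \<sigma> \<circ> chart_inv c"
  define U where "U = snd c ` (fst c \<inter> W)"
  have U: "open U" unfolding U_def using open_chart_image A c \<sigma> by blast
  have f: "ck_on 2 U f" unfolding f_def U_def using section_ck_on \<sigma> c by blast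
  note d = ck_on_2D[OF U f]
  note bc = bounded_linear_complexify
  have xU: "snd c x \<in> U" using c \<sigma> by (auto simp: U_def)
  have dds: "dd c s y X = complexify (pd X f (snd c y))" if "y \<in> fst c \<inter> W" for y X
  proof -
    have "s \<circ> chart_inv c = (\<lambda>z. complexify (f z))" by (auto simp: s_def f_def)
    moreover have "snd c y \<in> U" using that by (auto simp: U_def)
    ultimately show ?thesis
      unfolding dd_conv_pd using bounded_linear.pd[OF bc d(1)] by simp
  qed
  \<comment> \<open>The second complex derivative differentiates \<open>d_z c s\<close> as a
    function, so its coordinate expression \<open>h\<close> is needed on a neighbourhood and not
    only at \<open>x\<close>.\<close>
  define h where "h = (\<lambda>z. (1/2) *s (complexify (pd 1 f z) - \<i> *s complexify (pd \<i> f z)))"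
  have dz: "d_z c s y = h (snd c y)" if "y \<in> fst c \<inter> W" for y
    unfolding d_z_def h_def by (simp add: dds[OF that])
  have bs: "bounded_linear (\<lambda>v :: complex ^ 'k option. k *s v)" for k
    by (rule bounded_linear_vector_scalar_mult)
  have dc: "(\<lambda>z. complexify (pd Y f z)) differentiable (at (snd c x))"
    "pd X (\<lambda>z. complexify (pd Y f z)) (snd c x) = complexify (pd X (pd Y f) (snd c x))" for X Y
    using bounded_linear.differentiable[OF bc] bounded_linear.pd[OF bc] d(2)[OF xU] by blast+
  have dic: "(\<lambda>z. \<i> *s complexify (pd \<i> f z)) differentiable (at (snd c x))"
    "pd X (\<lambda>z. \<i> *s complexify (pd \<i> f z)) (snd c x) = \<i> *s complexify (pd X (pd \<i> f) (snd c x))" for X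
    using bounded_linear.differentiable[OF bs dc(1)] bounded_linear.pd[OF bs dc(1)] by (simp_all add: dc)
  have ddh: "dd c (d_z c s) x X
    = (1/2) *s (complexify (pd X (pd 1 f) (snd c x)) - \<i> *s complexify (pd X (pd \<i> f) (snd c x)))" for X
  proof -
    have "pd X (d_z c s \<circ> chart_inv c) (snd c x) = pd X h (snd c x)"
      using U xU by (rule pd_cong) (use dz chart_chart_inv[OF A c(1)] in \<open>auto simp: U_def\<close>)
    also have "\<dots> = (1/2) *s pd X (\<lambda>z. complexify (pd 1 f z) - \<i> *s complexify (pd \<i> f z)) (snd c x)"
      unfolding h_def by (rule bounded_linear.pd[OF bs differentiable_diff[OF dc(1) dic(1)]])
    finally show ?thesis unfolding dd_conv_pd by (simp add: pd_diff[OF dc(1) dic(1)] dc dic)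
  qed
  have fx: "s x = complexify (f (snd c x))"
    using chart_inv_chart[OF A c] by (simp add: s_def f_def)
  have zb: "d_zbar c s x = (1/2) *s (complexify (pd 1 f (snd c x)) + \<i> *s complexify (pd \<i> f (snd c x)))"
    unfolding d_zbar_def using dds[of x] c \<sigma> by simp
  \<comment> \<open>The imaginary part is the difference of the two mixed partial derivatives, which
    vanishes by Young's theorem; hence the value is a real vector.\<close>
  have zzb: "d_zbar c (d_z c s) x
    = (1/4) *s complexify (pd 1 (pd 1 f) (snd c x) + pd \<i> (pd \<i> f) (snd c x))"
    unfolding d_zbar_def ddh d(3)[OF xU]
    by (simp add: vec_eq_iff complexify_def field_simps)
  have z: "d_z c s x = (1/2) *s (complexify (pd 1 f (snd c x)) - \<i> *s complexify (pd \<i> f (snd c x)))"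
    using dz[of x] c \<sigma> by (simp add: h_def)
  show ?thesis
    unfolding fx z zb zzb f_def[symmetric] osc_def by (rule complexify_mem_span_iff)
qed

text \<open>Two moves: rescale the section within the chart \<open>c'\<close>, using that the time
  coordinate of a null vector is nonzero, then pass to \<open>c\<close> by the holomorphic
  transition map.\<close>

lemma osc_chart_section:
  assumes A: "riemann_surface A" and \<Lambda>: "null_line_bundle A \<Lambda>"
    and c: "c \<in> A" "x \<in> fst c" and c': "c' \<in> A" "x \<in> fst c'"
    and \<sigma>: "\<sigma> \<in> sections A \<Lambda> W" "open W" "x \<in> W"
    and \<sigma>': "\<sigma>' \<in> sections A \<Lambda> W'" "open W'" "x \<in> W'"
  shows "osc (\<sigma>' \<circ> chart_inv c') (snd c' x) \<subseteq> osc (\<sigma> \<circ> chart_inv c) (snd c x)"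
proof -
  define V where "V = snd c' ` (fst c' \<inter> (fst c \<inter> W \<inter> W'))"
  have V: "open V" unfolding V_def
    using A c' c \<sigma> \<sigma>' by (intro open_chart_image open_Int riemann_surfaceD)
  have xV: "snd c' x \<in> V" using c c' \<sigma> \<sigma>' by (auto simp: V_def)
  have "osc (\<sigma>' \<circ> chart_inv c') (snd c' x) \<subseteq> osc (\<sigma> \<circ> chart_inv c') (snd c' x)"
  proof (rule osc_scale[OF V xV])
    show "ck_on 2 V (\<sigma> \<circ> chart_inv c')"
      by (rule ck_on_subset[OF open_chart_image[OF A c'(1) \<sigma>(2)] V _ section_ck_on[OF \<sigma>(1) c'(1)]])
        (auto simp: V_def)
    show "ck_on 2 V (\<sigma>' \<circ> chart_inv c')"
      by (rule ck_on_subset[OF open_chart_image[OF A c'(1) \<sigma>'(2)] V _ section_ck_on[OF \<sigma>'(1) c'(1)]])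
        (auto simp: V_def)
    show "(\<sigma> \<circ> chart_inv c') (snd c' x) $ None \<noteq> 0"
      using mink_eq_0_imp_time_nz[OF section_line(2,3)[OF \<Lambda> \<sigma>(1,3)]] chart_inv_chart[OF A c'] by simp
  next
    fix z assume "z \<in> V"
    then have y: "chart_inv c' z \<in> W" "chart_inv c' z \<in> W'"
      using chart_chart_inv[OF A c'(1)] unfolding V_def by auto
    have "\<sigma>' (chart_inv c' z) \<in> span {\<sigma> (chart_inv c' z)}"
      using section_line(1)[OF \<Lambda> \<sigma>(1) y(1)] section_line(1)[OF \<Lambda> \<sigma>'(1) y(2)] span_base by blast
    then show "(\<sigma> \<circ> chart_inv c') z $ None *\<^sub>R (\<sigma>' \<circ> chart_inv c') z
      = (\<sigma>' \<circ> chart_inv c') z $ None *\<^sub>R (\<sigma> \<circ> chart_inv c') z"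
      by (auto simp: span_singleton)
  qed
  also have "osc (\<sigma> \<circ> chart_inv c') (snd c' x)
    = osc (\<lambda>z. (\<sigma> \<circ> chart_inv c) (transition c' c z)) (snd c' x)"
  proof -
    have eq: "(\<sigma> \<circ> chart_inv c') z = (\<sigma> \<circ> chart_inv c) (transition c' c z)" if "z \<in> V" for z
      using that chart_chart_inv[OF A c'(1)] chart_inv_chart[OF A c(1)]
      by (auto simp: V_def transition_def)
    have 1: "pd X (\<sigma> \<circ> chart_inv c') z = pd X (\<lambda>z. (\<sigma> \<circ> chart_inv c) (transition c' c z)) z"
      if "z \<in> V" for X z
      using V that eq by (rule pd_cong)
    have 2: "pd X (pd X (\<sigma> \<circ> chart_inv c')) (snd c' x)
      = pd X (pd X (\<lambda>z. (\<sigma> \<circ> chart_inv c) (transition c' c z))) (snd c' x)" for X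
      using V xV 1 by (rule pd_cong)
    show ?thesis unfolding osc_def 1[OF xV] 2 eq[OF xV] ..
  qed
  also have "\<dots> \<subseteq> osc (\<sigma> \<circ> chart_inv c) (transition c' c (snd c' x))"
  proof (rule osc_compose[OF _ _ V xV])
    show "open (snd c ` (fst c \<inter> W))" using A c \<sigma> open_chart_image by blast
    show "ck_on 2 (snd c ` (fst c \<inter> W)) (\<sigma> \<circ> chart_inv c)" using section_ck_on \<sigma> c by blast
    show "transition c' c holomorphic_on V"
      by (rule holomorphic_on_subset[OF riemann_surfaceD(4)[OF A c'(1) c(1)]]) (auto simp: V_def)
    show "\<And>z. z \<in> V \<Longrightarrow> transition c' c z \<in> snd c ` (fst c \<inter> W)"
      using chart_inv_chart[OF A c'(1)] by (auto simp: V_def transition_def)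
  qed
  also have "transition c' c (snd c' x) = snd c x"
    using chart_inv_chart[OF A c'] by (simp add: transition_def)
  finally show ?thesis .
qed

text \<open>The definition is a union over all charts and sections. Each member is contained in the
  given one, which is itself a member.\<close>

lemma central_sphere_eq_osc:
  assumes A: "riemann_surface A" and \<Lambda>: "null_line_bundle A \<Lambda>"
    and c: "c \<in> A" "x \<in> fst c" and \<sigma>: "\<sigma> \<in> sections A \<Lambda> W" "open W" "x \<in> W"
  shows "central_sphere A \<Lambda> x = osc (\<sigma> \<circ> chart_inv c) (snd c x)"
proof (intro equalityI subsetI)
  fix v assume "v \<in> central_sphere A \<Lambda> x"
  then obtain c' \<sigma>' W' where c': "c' \<in> A" "x \<in> fst c'"
    and \<sigma>': "\<sigma>' \<in> sections A \<Lambda> W'" "open W'" "x \<in> W'"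
    and v: "complexify v \<in> vec.span {(complexify \<circ> \<sigma>') x, d_z c' (complexify \<circ> \<sigma>') x,
      d_zbar c' (complexify \<circ> \<sigma>') x, d_zbar c' (d_z c' (complexify \<circ> \<sigma>')) x}"
    unfolding central_sphere_def local_sections_def Let_def by blast
  then have "v \<in> osc (\<sigma>' \<circ> chart_inv c') (snd c' x)"
    using central_sphere_chart[OF A c' \<sigma>'] by blast
  then show "v \<in> osc (\<sigma> \<circ> chart_inv c) (snd c x)"
    using osc_chart_section[OF A \<Lambda> c c' \<sigma> \<sigma>'] by blast
next
  fix v assume "v \<in> osc (\<sigma> \<circ> chart_inv c) (snd c x)"
  then have "complexify v \<in> vec.span {(complexify \<circ> \<sigma>) x, d_z c (complexify \<circ> \<sigma>) x,
      d_zbar c (complexify \<circ> \<sigma>) x, d_zbar c (d_z c (complexify \<circ> \<sigma>)) x}"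
    using central_sphere_chart[OF A c \<sigma>] by blast
  moreover have "\<sigma> \<in> local_sections A \<Lambda> x" using \<sigma> unfolding local_sections_def by blast
  ultimately show "v \<in> central_sphere A \<Lambda> x"
    unfolding central_sphere_def Let_def using c by blast
qed

locale surface_chart =
  fixes A :: "('m::{t2_space,second_countable_topology}) chart set"
    and \<Lambda> :: "'m \<Rightarrow> 'k::finite minkowski set" and c W \<sigma>
  assumes surf: "surface_in_sphere A \<Lambda>" and c: "c \<in> A" and W: "open W" and \<sigma>: "\<sigma> \<in> sections A \<Lambda> W"
begin

lemma A: "riemann_surface A" and \<Lambda>: "null_line_bundle A \<Lambda>"
  using surf by (auto simp: surface_in_sphere_def)

definition "U = snd c ` (fst c \<inter> W)"
definition "g = \<sigma> \<circ> chart_inv c"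

lemma U: "z \<in> U \<Longrightarrow> chart_inv c z \<in> fst c" "z \<in> U \<Longrightarrow> chart_inv c z \<in> W"
  "z \<in> U \<Longrightarrow> snd c (chart_inv c z) = z"
  using chart_chart_inv[OF A c] by (auto simp: U_def)

lemma local_section: "x \<in> W \<Longrightarrow> \<sigma> \<in> local_sections A \<Lambda> x"
  using W \<sigma> unfolding local_sections_def by blast

lemma dd_section: "z \<in> U \<Longrightarrow> dd c \<sigma> (chart_inv c z) X = pd X g z"
  by (simp add: dd_conv_pd g_def U)

lemma line: "z \<in> U \<Longrightarrow> \<Lambda> (chart_inv c z) = span {g z}"
  using section_line(1)[OF \<Lambda> \<sigma>] U by (simp add: g_def)

sublocale F: null_frame U g
proof
  show "open U" unfolding U_def using open_chart_image A c W by blast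
  show "ck_on 3 U g" unfolding U_def g_def using section_ck_on \<sigma> c by blast
  fix z assume z: "z \<in> U"
  show "mink (g z) (g z) = 0" "g z \<noteq> 0"
    using section_line(2,3)[OF \<Lambda> \<sigma>] U[OF z] by (auto simp: g_def)
  show "X = 0" if "pd X g z \<in> span {g z}" for X
    using surf c U[OF z] local_section[OF U(2)[OF z]] that dd_section[OF z] line[OF z]
    unfolding surface_in_sphere_def immersed_def by metis
  show "mink (pd (\<i> * X) g z) (pd (\<i> * Y) g z) = mink (pd X g z) (pd Y g z)" for X Y
    using surf c U[OF z] local_section[OF U(2)[OF z]] dd_section[OF z]
    unfolding surface_in_sphere_def conformal_def induced_metric_def by metis
qed

section \<open>The connection \<open>\<D>\<close> in a chart\<close>

lemma proj_central_sphere: "z \<in> U \<Longrightarrow> proj (central_sphere A \<Lambda> (chart_inv c z)) v = F.P z *v v"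
proof -
  assume z: "z \<in> U"
  have "central_sphere A \<Lambda> (chart_inv c z) = osc g z"
    using central_sphere_eq_osc[OF A \<Lambda> c U(1)[OF z] \<sigma> W U(2)[OF z]] U(3)[OF z] by (simp add: g_def)
  also have "\<dots> = F.sphere z"
    by (simp add: osc_def F.sphere_def F.w_def F.aa_def F.bb_def F.a_def F.b_def)
  finally show ?thesis using F.proj_sphere[OF z] by simp
qed

lemma conn_D_eq:
  assumes z: "z \<in> U" and k: "(\<lambda>y. f (chart_inv c y)) differentiable (at z)"
  shows "conn_D (central_sphere A \<Lambda>) c f (chart_inv c z) X
    = pd X (\<lambda>y. f (chart_inv c y)) z - F.N X z *v f (chart_inv c z)"
proof -
  define h where "h = (\<lambda>y. f (chart_inv c y))"
  have h: "h differentiable (at z)" using k by (simp add: h_def)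
  have 1: "dd c (\<lambda>x. proj (central_sphere A \<Lambda> x) (f x)) (chart_inv c z) X = pd X (\<lambda>y. F.P y *v h y) z"
    unfolding dd_conv_pd U(3)[OF z] o_def h_def
    using F.open_U z by (rule pd_cong) (simp add: proj_central_sphere)
  have 2: "dd c (\<lambda>x. proj_perp (central_sphere A \<Lambda> x) (f x)) (chart_inv c z) X
      = pd X (\<lambda>y. h y - F.P y *v h y) z"
    unfolding dd_conv_pd U(3)[OF z] o_def h_def
    using F.open_U z by (rule pd_cong) (simp add: proj_perp_def proj_central_sphere)
  have Ph: "(\<lambda>y. F.P y *v h y) differentiable (at z)"
    "pd X (\<lambda>y. F.P y *v h y) z = F.P z *v pd X h z + pd X F.P z *v h z"
    using mvm.differentiable[of F.P z h] mvm.pd[of F.P z h X] h z by auto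
  show ?thesis
    unfolding conn_D_def 1 2 unfolding pd_diff[OF h Ph(1)] Ph(2) proj_perp_def proj_central_sphere[OF z]
    using F.pd_P[OF z, of X "h z"] h_def F.P_idem[OF z]
    by (simp add: F.N_def lie_apply mvm.add_right mvm.diff_right algebra_simps)
qed

lemma form_N_eq: "z \<in> U \<Longrightarrow> form_N (central_sphere A \<Lambda>) c (chart_inv c z) X = F.N X z"
  unfolding form_N_def by (simp add: conn_D_eq dd_conv_pd o_def)

lemma conn_D_end_eq:
  assumes z: "z \<in> U" and k: "(\<lambda>y. B (chart_inv c y)) differentiable (at z)"
  shows "conn_D_end (central_sphere A \<Lambda>) c B (chart_inv c z) X
    = pd X (\<lambda>y. B (chart_inv c y)) z - lie (F.N X z) (B (chart_inv c z))"
proof -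
  have "conn_D (central_sphere A \<Lambda>) c (\<lambda>x. B x *v v) (chart_inv c z) X
      - B (chart_inv c z) *v conn_D (central_sphere A \<Lambda>) c (\<lambda>_. v) (chart_inv c z) X
    = (pd X (\<lambda>y. B (chart_inv c y)) z - lie (F.N X z) (B (chart_inv c z))) *v v" for v
  proof -
    have "(\<lambda>y. B (chart_inv c y) *v v) differentiable (at z)"
      "pd X (\<lambda>y. B (chart_inv c y) *v v) z = pd X (\<lambda>y. B (chart_inv c y)) z *v v"
      using mvm.differentiable[OF k, of "\<lambda>_. v"] mvm.pd[OF k, of "\<lambda>_. v"] by (simp_all add: mvm.zero_right)
    then show ?thesis
      by (simp add: conn_D_eq z lie_apply mvm.minus_right mvm.diff_left mvm.zero_left)
  qed
  then show ?thesis unfolding conn_D_end_def by simp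
qed

text \<open>Not formal: derivatives are additive only for differentiable arguments, so both sides
  are first brought to the form given by \<open>conn_D_end_eq\<close>.\<close>

lemma ext_D_add_diff:
  assumes z: "z \<in> U" and \<mu>: "one_form A \<mu>" and \<eta>: "one_form A \<eta>"
  shows "ext_D (central_sphere A \<Lambda>) (\<lambda>c p X. \<mu> c p X + \<eta> c p X) c (chart_inv c z) X Y
      = ext_D (central_sphere A \<Lambda>) \<mu> c (chart_inv c z) X Y + ext_D (central_sphere A \<Lambda>) \<eta> c (chart_inv c z) X Y"
    "ext_D (central_sphere A \<Lambda>) (\<lambda>c p X. \<mu> c p X - \<eta> c p X) c (chart_inv c z) X Y
      = ext_D (central_sphere A \<Lambda>) \<mu> c (chart_inv c z) X Y - ext_D (central_sphere A \<Lambda>) \<eta> c (chart_inv c z) X Y"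
proof -
  have z': "z \<in> snd c ` fst c" using z by (auto simp: U_def)
  note d = one_form_differentiable[OF A \<mu> c z'] one_form_differentiable[OF A \<eta> c z']
  show "ext_D (central_sphere A \<Lambda>) (\<lambda>c p X. \<mu> c p X + \<eta> c p X) c (chart_inv c z) X Y
      = ext_D (central_sphere A \<Lambda>) \<mu> c (chart_inv c z) X Y + ext_D (central_sphere A \<Lambda>) \<eta> c (chart_inv c z) X Y"
    unfolding ext_D_def conn_D_end_eq[OF z differentiable_add[OF d]] conn_D_end_eq[OF z d(1)]
      conn_D_end_eq[OF z d(2)] pd_add[OF d]
    by (simp add: lie.add_right)
  show "ext_D (central_sphere A \<Lambda>) (\<lambda>c p X. \<mu> c p X - \<eta> c p X) c (chart_inv c z) X Y
      = ext_D (central_sphere A \<Lambda>) \<mu> c (chart_inv c z) X Y - ext_D (central_sphere A \<Lambda>) \<eta> c (chart_inv c z) X Y"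
    unfolding ext_D_def conn_D_end_eq[OF z differentiable_diff[OF d]] conn_D_end_eq[OF z d(1)]
      conn_D_end_eq[OF z d(2)] pd_diff[OF d]
    by (simp add: lie.diff_right)
qed

section \<open>Forms through their two coefficients in a chart\<close>

definition "form_coeff \<mu> X z = (\<mu> c (chart_inv c z) X :: 'k minkowski_end)"

definition area :: "complex \<Rightarrow> complex \<Rightarrow> real" where
  "area X Y = Re X * Im Y - Im X * Re Y"

context
  fixes \<mu> :: "('m, 'k) form1"
  assumes \<mu>: "one_form A \<mu>"
begin

lemma differentiable_form_coeff: "z \<in> U \<Longrightarrow> form_coeff \<mu> X differentiable (at z)"
  unfolding form_coeff_def[abs_def] using one_form_differentiable[OF A \<mu> c] by (auto simp: U_def)

lemma form_coeff_expand: "z \<in> U \<Longrightarrow> form_coeff \<mu> X z = Re X *\<^sub>R form_coeff \<mu> 1 z + Im X *\<^sub>R form_coeff \<mu> \<i> z"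
  unfolding form_coeff_def using linear_complex_expand[OF one_form_linear[OF \<mu> c U(1)]] .

lemma pd_form_coeff:
  assumes z: "z \<in> U"
  shows "pd X (form_coeff \<mu> Y) z = Re Y *\<^sub>R (Re X *\<^sub>R pd 1 (form_coeff \<mu> 1) z + Im X *\<^sub>R pd \<i> (form_coeff \<mu> 1) z)
    + Im Y *\<^sub>R (Re X *\<^sub>R pd 1 (form_coeff \<mu> \<i>) z + Im X *\<^sub>R pd \<i> (form_coeff \<mu> \<i>) z)"
proof -
  note d = differentiable_form_coeff[OF z]
  have sc: "(\<lambda>y. r *\<^sub>R form_coeff \<mu> V y) differentiable (at z)"
    "pd X (\<lambda>y. r *\<^sub>R form_coeff \<mu> V y) z = r *\<^sub>R pd X (form_coeff \<mu> V) z" for r V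
    using bounded_linear.differentiable[OF bounded_linear_scaleR_right d]
      bounded_linear.pd[OF bounded_linear_scaleR_right d] by auto
  have "pd X (form_coeff \<mu> Y) z = pd X (\<lambda>y. Re Y *\<^sub>R form_coeff \<mu> 1 y + Im Y *\<^sub>R form_coeff \<mu> \<i> y) z"
    using F.open_U z form_coeff_expand by (rule pd_cong)
  also have "\<dots> = Re Y *\<^sub>R pd X (form_coeff \<mu> 1) z + Im Y *\<^sub>R pd X (form_coeff \<mu> \<i>) z"
    using pd_add[OF sc(1) sc(1)] by (simp add: sc(2))
  finally show ?thesis
    using pd_expand[OF d, of X 1] pd_expand[OF d, of X \<i>] by simp
qed

lemma N_expand: "z \<in> U \<Longrightarrow> F.N X z = Re X *\<^sub>R F.N 1 z + Im X *\<^sub>R F.N \<i> z"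
  unfolding F.N_def using pd_expand[OF F.differentiable_P, of z X]
  by (simp add: lie.add_left lie.scaleR_left)

lemma ext_d_eq:
  assumes z: "z \<in> U"
  shows "ext_d \<mu> c (chart_inv c z) X Y = area X Y *\<^sub>R F.dform (form_coeff \<mu> 1) (form_coeff \<mu> \<i>) z"
proof -
  have "dd c (\<lambda>x. \<mu> c x Y) (chart_inv c z) X = pd X (form_coeff \<mu> Y) z" for X Y
    unfolding dd_conv_pd U(3)[OF z] by (simp add: o_def form_coeff_def[abs_def])
  then show ?thesis
    unfolding ext_d_def F.dform_def pd_form_coeff[OF z, of X Y] pd_form_coeff[OF z, of Y X]
    by (simp add: area_def pd_form_coeff[OF z, of X Y] pd_form_coeff[OF z, of Y X] algebra_simps)
qed

lemma lie_N_form_coeff: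
  assumes z: "z \<in> U"
  shows "lie (F.N X z) (form_coeff \<mu> Y z) - lie (F.N Y z) (form_coeff \<mu> X z)
    = area X Y *\<^sub>R F.NW (form_coeff \<mu> 1) (form_coeff \<mu> \<i>) z"
  unfolding F.NW_def N_expand[OF z, of X] N_expand[OF z, of Y]
    form_coeff_expand[OF z, of X] form_coeff_expand[OF z, of Y]
  by (simp add: area_def lie.add_left lie.add_right lie.scaleR_left lie.scaleR_right algebra_simps)

lemma ext_D_eq:
  assumes z: "z \<in> U"
  shows "ext_D (central_sphere A \<Lambda>) \<mu> c (chart_inv c z) X Y
    = area X Y *\<^sub>R (F.dform (form_coeff \<mu> 1) (form_coeff \<mu> \<i>) z - F.NW (form_coeff \<mu> 1) (form_coeff \<mu> \<i>) z)"
proof -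
  have k: "(\<lambda>y. \<mu> c (chart_inv c y) X) differentiable (at z)" for X
    using differentiable_form_coeff[OF z, of X] by (simp add: form_coeff_def[abs_def])
  have "ext_D (central_sphere A \<Lambda>) \<mu> c (chart_inv c z) X Y
    = ext_d \<mu> c (chart_inv c z) X Y - (lie (F.N X z) (form_coeff \<mu> Y z) - lie (F.N Y z) (form_coeff \<mu> X z))"
    unfolding ext_D_def ext_d_def conn_D_end_eq[OF z k] dd_conv_pd U(3)[OF z]
    by (simp add: o_def form_coeff_def algebra_simps)
  then show ?thesis
    unfolding ext_d_eq[OF z] lie_N_form_coeff[OF z] by (simp add: scaleR_diff_right)
qed

text \<open>The star of \<open>\<N>\<close> takes the values \<open>- N \<i>\<close> and
  \<open>N 1\<close> on the coordinate directions; the sign comes from swapping the arguments of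
  \<open>lie\<close>.\<close>

lemma lie_wedge_star_N_eq:
  assumes z: "z \<in> U"
  shows "lie_wedge \<mu> (star (form_N (central_sphere A \<Lambda>))) c (chart_inv c z) X Y
    = - (area X Y *\<^sub>R F.NC (form_coeff \<mu> 1) (form_coeff \<mu> \<i>) z)"
proof -
  have N: "star (form_N (central_sphere A \<Lambda>)) c (chart_inv c z) X = Im X *\<^sub>R F.N 1 z - Re X *\<^sub>R F.N \<i> z" for X
    unfolding star_def form_N_eq[OF z] N_expand[OF z, of "\<i> * X"] by simp
  have "lie_wedge \<mu> (star (form_N (central_sphere A \<Lambda>))) c (chart_inv c z) X Y
    = lie (form_coeff \<mu> X z) (star (form_N (central_sphere A \<Lambda>)) c (chart_inv c z) Y)
      - lie (form_coeff \<mu> Y z) (star (form_N (central_sphere A \<Lambda>)) c (chart_inv c z) X)"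
    by (simp add: lie_wedge_def form_coeff_def)
  then show ?thesis
    unfolding F.NC_def N form_coeff_expand[OF z, of X] form_coeff_expand[OF z, of Y]
      lie_skew[of "F.N _ z" "form_coeff \<mu> _ z"]
    by (simp add: area_def lie.add_left lie.add_right lie.diff_left lie.diff_right lie.scaleR_left
        lie.scaleR_right algebra_simps)
qed

lemma form_coeff_star:
  assumes z: "z \<in> U"
  shows "form_coeff (star \<mu>) 1 z = - form_coeff \<mu> \<i> z" "form_coeff (star \<mu>) \<i> z = form_coeff \<mu> 1 z"
  using linear_neg[OF one_form_linear[OF \<mu> c U(1)[OF z]], of 1]
  by (simp_all add: form_coeff_def star_def)

lemma star_eq:
  assumes z: "z \<in> U"
  shows "F.dform (form_coeff (star \<mu>) 1) (form_coeff (star \<mu>) \<i>) z = F.cod (form_coeff \<mu> 1) (form_coeff \<mu> \<i>) z"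
    "F.NW (form_coeff (star \<mu>) 1) (form_coeff (star \<mu>) \<i>) z = F.NC (form_coeff \<mu> 1) (form_coeff \<mu> \<i>) z"
    "F.NC (form_coeff (star \<mu>) 1) (form_coeff (star \<mu>) \<i>) z = - F.NW (form_coeff \<mu> 1) (form_coeff \<mu> \<i>) z"
proof -
  have 1: "pd X (form_coeff (star \<mu>) 1) z = - pd X (form_coeff \<mu> \<i>) z" for X
    using pd_cong[OF F.open_U z form_coeff_star(1)] pd_minus[OF differentiable_form_coeff[OF z]] by simp
  have 2: "pd X (form_coeff (star \<mu>) \<i>) z = pd X (form_coeff \<mu> 1) z" for X
    using pd_cong[OF F.open_U z form_coeff_star(2)] .
  show "F.dform (form_coeff (star \<mu>) 1) (form_coeff (star \<mu>) \<i>) z = F.cod (form_coeff \<mu> 1) (form_coeff \<mu> \<i>) z"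
    by (simp add: F.dform_def F.cod_def 1 2)
  show "F.NW (form_coeff (star \<mu>) 1) (form_coeff (star \<mu>) \<i>) z = F.NC (form_coeff \<mu> 1) (form_coeff \<mu> \<i>) z"
    "F.NC (form_coeff (star \<mu>) 1) (form_coeff (star \<mu>) \<i>) z = - F.NW (form_coeff \<mu> 1) (form_coeff \<mu> \<i>) z"
    by (simp_all add: F.NW_def F.NC_def form_coeff_star[OF z] lie.minus_right)
qed

text \<open>Used with \<open>k = 1\<close> for forms closed under \<open>\<D>\<close> and with
  \<open>k = 0\<close> for closed ones. The last claim narrows the values from
  \<open>mink_perp (\<Lambda> p)\<close> to \<open>first_derived A \<Lambda> p\<close>, as a
  multiplier requires.\<close>

lemma form_coeff_closed:
  assumes z: "z \<in> U"
    and v: "values_in A \<mu> (\<lambda>p. wedge_space (\<Lambda> p) (mink_perp (\<Lambda> p)))"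
    and eq: "\<And>x. x \<in> U \<Longrightarrow> F.dform (form_coeff \<mu> 1) (form_coeff \<mu> \<i>) x = k *\<^sub>R F.NW (form_coeff \<mu> 1) (form_coeff \<mu> \<i>) x"
  shows "F.dform (form_coeff \<mu> 1) (form_coeff \<mu> \<i>) z = F.NW (form_coeff \<mu> 1) (form_coeff \<mu> \<i>) z"
    "F.cod (form_coeff \<mu> 1) (form_coeff \<mu> \<i>) z = F.NC (form_coeff \<mu> 1) (form_coeff \<mu> \<i>) z"
    "form_coeff \<mu> X z \<in> wedge_space (\<Lambda> (chart_inv c z)) (first_derived A \<Lambda> (chart_inv c z))"
proof -
  have perp: "mink_perp (span {u}) = mink_perp {u}" for u :: "'k minkowski"
    by (auto simp: mink_perp_def span_singleton mink_simps)
  have vals: "form_coeff \<mu> X x \<in> wedge (g x) ` mink_perp {g x}" if x: "x \<in> U" for X x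
  proof -
    have "form_coeff \<mu> X x \<in> wedge_space (span {g x}) (mink_perp {g x})"
      using v c U(1)[OF x] line[OF x] perp unfolding values_in_def form_coeff_def by metis
    then show ?thesis
      using wedge_space_line[OF subspace_mink_perp F.nz[OF x]] by blast
  qed
  note * = F.dform_cod_eq[OF z differentiable_form_coeff differentiable_form_coeff vals vals eq]
  show "F.dform (form_coeff \<mu> 1) (form_coeff \<mu> \<i>) z = F.NW (form_coeff \<mu> 1) (form_coeff \<mu> \<i>) z"
    "F.cod (form_coeff \<mu> 1) (form_coeff \<mu> \<i>) z = F.NC (form_coeff \<mu> 1) (form_coeff \<mu> \<i>) z"
    using *(1,2) by auto
  \<comment> \<open>\<open>first_derived\<close> collects vectors over all charts and sections;
    containing the span from this chart and section is enough.\<close>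
  have "span {g z, F.a z, F.b z} \<subseteq> first_derived A \<Lambda> (chart_inv c z)"
  proof
    fix v assume "v \<in> span {g z, F.a z, F.b z}"
    moreover have "span {g z, F.a z, F.b z}
      \<subseteq> span (insert (\<sigma> (chart_inv c z)) (range (dd c \<sigma> (chart_inv c z))))"
    proof (rule span_mono)
      have "F.a z = dd c \<sigma> (chart_inv c z) 1" "F.b z = dd c \<sigma> (chart_inv c z) \<i>"
        "g z = \<sigma> (chart_inv c z)"
        by (simp_all add: dd_section[OF z] F.a_def F.b_def) (simp add: g_def)
      then show "{g z, F.a z, F.b z} \<subseteq> insert (\<sigma> (chart_inv c z)) (range (dd c \<sigma> (chart_inv c z)))"
        by simp
    qed
    ultimately show "v \<in> first_derived A \<Lambda> (chart_inv c z)"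
      unfolding first_derived_def using c U(1)[OF z] local_section[OF U(2)[OF z]] by blast
  qed
  moreover have "g z \<in> \<Lambda> (chart_inv c z)" using line[OF z] span_base by auto
  ultimately have "wedge (g z) ` span {g z, F.a z, F.b z}
    \<subseteq> wedge_space (\<Lambda> (chart_inv c z)) (first_derived A \<Lambda> (chart_inv c z))"
    unfolding wedge_space_def by (auto intro!: span_base)
  then have "form_coeff \<mu> 1 z \<in> wedge_space (\<Lambda> (chart_inv c z)) (first_derived A \<Lambda> (chart_inv c z))"
    "form_coeff \<mu> \<i> z \<in> wedge_space (\<Lambda> (chart_inv c z)) (first_derived A \<Lambda> (chart_inv c z))"
    using *(3,4) by auto
  then show "form_coeff \<mu> X z \<in> wedge_space (\<Lambda> (chart_inv c z)) (first_derived A \<Lambda> (chart_inv c z))"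
    unfolding form_coeff_expand[OF z, of X] wedge_space_def by (intro span_add span_scale)
qed

end

end


section \<open>Multipliers and isothermic surfaces\<close>

lemma surface_chart_at:
  assumes "surface_in_sphere A \<Lambda>" "c \<in> A" "p \<in> fst c"
  obtains W \<sigma> where "surface_chart A \<Lambda> c W \<sigma>" "snd c p \<in> surface_chart.U c W" "chart_inv c (snd c p) = p"
proof -
  have A: "riemann_surface A" and "null_line_bundle A \<Lambda>"
    using assms(1) by (auto simp: surface_in_sphere_def)
  then obtain \<sigma> W where W: "open W" "p \<in> W" "\<sigma> \<in> sections A \<Lambda> W"
    unfolding null_line_bundle_def local_sections_def by blast
  have S: "surface_chart A \<Lambda> c W \<sigma>"
    using assms W by unfold_locales
  show thesis
  proof
    show "surface_chart A \<Lambda> c W \<sigma>" by fact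
    show "snd c p \<in> surface_chart.U c W"
      using assms W unfolding surface_chart.U_def[OF S] by auto
    show "chart_inv c (snd c p) = p" using chart_inv_chart[OF A assms(2,3)] .
  qed
qed

text \<open>The derivative of a null section is orthogonal to it. This places differences of
  multipliers among the forms considered for isothermic surfaces.\<close>

lemma first_derived_perp:
  assumes "surface_in_sphere A \<Lambda>"
  shows "first_derived A \<Lambda> p \<subseteq> mink_perp (\<Lambda> p)"
proof
  fix v assume "v \<in> first_derived A \<Lambda> p"
  then obtain c \<sigma> W where cp: "c \<in> A" "p \<in> fst c" and Wp: "open W" "p \<in> W" "\<sigma> \<in> sections A \<Lambda> W"
    and v: "v \<in> span (insert (\<sigma> p) (range (dd c \<sigma> p)))"
    unfolding first_derived_def local_sections_def by blast
  interpret surface_chart A \<Lambda> c W \<sigma>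
    using assms cp Wp by unfold_locales
  define z where "z = snd c p"
  have z: "z \<in> U" "chart_inv c z = p"
    using cp Wp chart_inv_chart[OF A cp] by (auto simp: z_def U_def)
  have "insert (\<sigma> p) (range (dd c \<sigma> p)) \<subseteq> mink_perp (\<Lambda> p)"
  proof -
    have eqs: "\<sigma> p = g z" "dd c \<sigma> p = (\<lambda>X. pd X g z)" "\<Lambda> p = span {g z}"
      using z line[OF z(1)] dd_section[OF z(1)] by (auto simp: g_def)
    have "mink (pd X g z) (g z) = 0" for X
      using F.mink_g_pd[OF z(1), of X] mink_commute[of "g z" "pd X g z"] by simp
    then show ?thesis
      unfolding eqs using F.null[OF z(1)] by (auto simp: mink_perp_def span_singleton mink_simps)
  qed
  then have "span (insert (\<sigma> p) (range (dd c \<sigma> p))) \<subseteq> mink_perp (\<Lambda> p)"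
    by (rule span_minimal[OF _ subspace_mink_perp])
  then show "v \<in> mink_perp (\<Lambda> p)" using v by blast
qed

lemma subspace_wedge_space: "subspace (wedge_space V W)"
  by (simp add: wedge_space_def)

lemma wedge_space_mono: "W \<subseteq> W' \<Longrightarrow> wedge_space V W \<subseteq> wedge_space V W'"
  unfolding wedge_space_def by (intro span_mono) auto

lemma values_in_star:
  assumes "values_in A \<mu> (\<lambda>p. wedge_space (V p) (W p))"
  shows "values_in A (star \<mu>) (\<lambda>p. wedge_space (V p) (W p))"
  using assms unfolding values_in_def star_def by (auto intro: subspace_neg subspace_wedge_space)

text \<open>The case \<open>k = 1\<close>: closedness under \<open>\<D>\<close> makes
  \<open>d *\<mu>\<close> the bracket \<open>[\<N> \<and> *\<mu>]\<close>, which is minus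
  \<open>[\<mu> \<and> *\<N>]\<close> and vanishes by assumption.\<close>

lemma star_closed:
  assumes surf: "surface_in_sphere A \<Lambda>" and \<mu>: "one_form A \<mu>"
    and v: "values_in A \<mu> (\<lambda>p. wedge_space (\<Lambda> p) (mink_perp (\<Lambda> p)))"
    and D: "\<And>c p X Y. c \<in> A \<Longrightarrow> p \<in> fst c \<Longrightarrow> ext_D (central_sphere A \<Lambda>) \<mu> c p X Y = 0"
    and L: "\<And>c p X Y. c \<in> A \<Longrightarrow> p \<in> fst c \<Longrightarrow>
      lie_wedge \<mu> (star (form_N (central_sphere A \<Lambda>))) c p X Y = 0"
    and c: "c \<in> A" "p \<in> fst c"
  shows "ext_d (star \<mu>) c p X Y = 0"
proof -
  obtain W \<sigma> where sc: "surface_chart A \<Lambda> c W \<sigma>" and p: "snd c p \<in> surface_chart.U c W" "chart_inv c (snd c p) = p"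
    using surface_chart_at[OF surf c] .
  interpret surface_chart A \<Lambda> c W \<sigma> by fact
  have eq: "F.dform (form_coeff \<mu> 1) (form_coeff \<mu> \<i>) z = 1 *\<^sub>R F.NW (form_coeff \<mu> 1) (form_coeff \<mu> \<i>) z"
    if z: "z \<in> U" for z
    using D[OF c(1) U(1)[OF z], of 1 \<i>] unfolding ext_D_eq[OF \<mu> z] by (simp add: area_def)
  have "F.cod (form_coeff \<mu> 1) (form_coeff \<mu> \<i>) (snd c p) = F.NC (form_coeff \<mu> 1) (form_coeff \<mu> \<i>) (snd c p)"
    using form_coeff_closed(2)[OF \<mu> p(1) v eq] .
  also have "\<dots> = 0"
    using L[OF c(1) U(1)[OF p(1)], of 1 \<i>] unfolding lie_wedge_star_N_eq[OF \<mu> p(1)] by (simp add: area_def)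
  finally show ?thesis
    using ext_d_eq[OF one_form_star[OF A \<mu>] p(1), of X Y] star_eq(1)[OF \<mu> p(1)] p(2) by simp
qed

text \<open>The case \<open>k = 0\<close>: \<open>d \<mu>\<close> is both 0 and the bracket with
  \<open>\<N>\<close>, so that bracket vanishes. As the double star is negation, it is also the
  bracket of \<open>*\<mu>\<close> with \<open>*\<N>\<close>.\<close>

lemma star_of_closed:
  assumes surf: "surface_in_sphere A \<Lambda>" and \<mu>: "one_form A \<mu>"
    and v: "values_in A \<mu> (\<lambda>p. wedge_space (\<Lambda> p) (mink_perp (\<Lambda> p)))"
    and d: "\<And>c p X Y. c \<in> A \<Longrightarrow> p \<in> fst c \<Longrightarrow> ext_d \<mu> c p X Y = 0"
    and c: "c \<in> A" "p \<in> fst c"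
  shows "ext_D (central_sphere A \<Lambda>) (star \<mu>) c p X Y = 0"
    "lie_wedge (star \<mu>) (star (form_N (central_sphere A \<Lambda>))) c p X Y = 0"
    "\<mu> c p X \<in> wedge_space (\<Lambda> p) (first_derived A \<Lambda> p)"
proof -
  obtain W \<sigma> where sc: "surface_chart A \<Lambda> c W \<sigma>" and p: "snd c p \<in> surface_chart.U c W" "chart_inv c (snd c p) = p"
    using surface_chart_at[OF surf c] .
  interpret surface_chart A \<Lambda> c W \<sigma> by fact
  have d0: "F.dform (form_coeff \<mu> 1) (form_coeff \<mu> \<i>) z = 0" if z: "z \<in> U" for z
    using d[OF c(1) U(1)[OF z], of 1 \<i>] unfolding ext_d_eq[OF \<mu> z] by (simp add: area_def)
  then have eq: "F.dform (form_coeff \<mu> 1) (form_coeff \<mu> \<i>) z = 0 *\<^sub>R F.NW (form_coeff \<mu> 1) (form_coeff \<mu> \<i>) z"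
    if "z \<in> U" for z using that by simp
  note * = form_coeff_closed[OF \<mu> p(1) v eq]
  show "ext_D (central_sphere A \<Lambda>) (star \<mu>) c p X Y = 0"
    using ext_D_eq[OF one_form_star[OF A \<mu>] p(1), of X Y] *(2) star_eq[OF \<mu> p(1)] p(2) by simp
  show "lie_wedge (star \<mu>) (star (form_N (central_sphere A \<Lambda>))) c p X Y = 0"
    using lie_wedge_star_N_eq[OF one_form_star[OF A \<mu>] p(1), of X Y] *(1) d0[OF p(1)]
      star_eq[OF \<mu> p(1)] p(2) by simp
  show "\<mu> c p X \<in> wedge_space (\<Lambda> p) (first_derived A \<Lambda> p)"
    using *(3)[of X] p(2) by (simp add: form_coeff_def)
qed

theorem theorem8p11:
  fixes n :: nat
    and A :: "('m::{t2_space,second_countable_topology}) chart set"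
    and \<Lambda> :: "'m \<Rightarrow> 'k::finite minkowski set"
  assumes "n \<ge> 3" and "CARD('k) = n + 1"
    and "surface_in_sphere A \<Lambda>"
    and "constrained_willmore A \<Lambda>"
  shows "(\<exists>!q. multiplier A \<Lambda> q) \<longleftrightarrow> \<not> isothermic A \<Lambda>"
proof -
  note surf = assms(3)
  have A: "riemann_surface A" using surf by (simp add: surface_in_sphere_def)
  define S where "S = central_sphere A \<Lambda>"
  define sN where "sN = star (form_N S)"
  have mult_iff: "multiplier A \<Lambda> q \<longleftrightarrow> one_form A q \<and>
      values_in A q (\<lambda>p. wedge_space (\<Lambda> p) (first_derived A \<Lambda> p)) \<and>
      (\<forall>c\<in>A. \<forall>p\<in>fst c. \<forall>X Y. ext_D S q c p X Y = 0) \<and>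
      (\<forall>c\<in>A. \<forall>p\<in>fst c. \<forall>X Y. ext_D S sN c p X Y = 2 *\<^sub>R lie_wedge q sN c p X Y)" for q
    unfolding multiplier_def Let_def S_def[symmetric] sN_def[symmetric] by blast
  have ext_D_add_diff:
    "ext_D S (\<lambda>c p X. q c p X + r c p X) c p X Y = ext_D S q c p X Y + ext_D S r c p X Y"
    "ext_D S (\<lambda>c p X. q c p X - r c p X) c p X Y = ext_D S q c p X Y - ext_D S r c p X Y"
    if qr: "one_form A q" "one_form A r" "c \<in> A" "p \<in> fst c" for q r c p X Y
  proof -
    obtain W \<sigma> where sc: "surface_chart A \<Lambda> c W \<sigma>"
      and p: "snd c p \<in> surface_chart.U c W" "chart_inv c (snd c p) = p"
      using surface_chart_at[OF surf qr(3,4)] .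
    show "ext_D S (\<lambda>c p X. q c p X + r c p X) c p X Y = ext_D S q c p X Y + ext_D S r c p X Y"
      "ext_D S (\<lambda>c p X. q c p X - r c p X) c p X Y = ext_D S q c p X Y - ext_D S r c p X Y"
      using surface_chart.ext_D_add_diff[OF sc p(1) qr(1,2), of X Y] p(2) by (simp_all add: S_def)
  qed
  obtain q where q: "multiplier A \<Lambda> q" using assms(4) unfolding constrained_willmore_def by blast
  show ?thesis
  proof
    assume unique: "\<exists>!q. multiplier A \<Lambda> q"
    show "\<not> isothermic A \<Lambda>"
    proof
      assume "isothermic A \<Lambda>"
      then obtain \<eta> where \<eta>: "one_form A \<eta>"
          "values_in A \<eta> (\<lambda>p. wedge_space (\<Lambda> p) (mink_perp (\<Lambda> p)))"
          "\<And>c p X Y. c \<in> A \<Longrightarrow> p \<in> fst c \<Longrightarrow> ext_d \<eta> c p X Y = 0"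
          and nz: "\<exists>c\<in>A. \<exists>p\<in>fst c. \<exists>X. \<eta> c p X \<noteq> 0"
        unfolding isothermic_def by blast
      have s: "ext_D S (star \<eta>) c p X Y = 0" "lie_wedge (star \<eta>) sN c p X Y = 0"
        "\<eta> c p X \<in> wedge_space (\<Lambda> p) (first_derived A \<Lambda> p)"
        if c: "c \<in> A" "p \<in> fst c" for c p X Y
        unfolding S_def sN_def
        by (rule star_of_closed[OF surf \<eta>(1,2) _ c], rule \<eta>(3), assumption+)+
      \<comment> \<open>The star of \<open>\<eta>\<close> solves the homogeneous equations, so
        adding it to \<open>q\<close> gives a second multiplier.\<close>
      define r where "r = (\<lambda>c p X. q c p X + star \<eta> c p X)"
      have "values_in A \<eta> (\<lambda>p. wedge_space (\<Lambda> p) (first_derived A \<Lambda> p))"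
        unfolding values_in_def using s(3) by blast
      note v = values_in_star[OF this]
      have "multiplier A \<Lambda> r"
        unfolding mult_iff
      proof (intro conjI ballI allI)
        show "one_form A r"
          unfolding r_def using q by (intro one_form_add A one_form_star \<eta>(1)) (simp add: mult_iff)
        show "values_in A r (\<lambda>p. wedge_space (\<Lambda> p) (first_derived A \<Lambda> p))"
          using q v unfolding mult_iff r_def values_in_def
          by (auto intro: subspace_add subspace_wedge_space)
        fix c p X Y assume c: "c \<in> A" "p \<in> fst c"
        show "ext_D S r c p X Y = 0"
          unfolding r_def using q s(1)[OF c] c ext_D_add_diff(1)[OF _ one_form_star[OF A \<eta>(1)] c]
          by (simp add: mult_iff)
        have "lie_wedge r sN c p X Y = lie_wedge q sN c p X Y + lie_wedge (star \<eta>) sN c p X Y"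
          by (simp add: lie_wedge_def r_def lie.add_left)
        then show "ext_D S sN c p X Y = 2 *\<^sub>R lie_wedge r sN c p X Y"
          using q s(2)[OF c] c by (simp add: mult_iff)
      qed
      with unique q have "r = q" by blast
      obtain c p X where "\<eta> c p X \<noteq> 0" using nz by blast
      \<comment> \<open>Multiplying \<open>- \<i> * X\<close> by \<open>\<i>\<close> returns
        \<open>X\<close>, so the value there is \<open>- \<eta> c p X\<close>.\<close>
      then have "star \<eta> c p (- \<i> * X) \<noteq> 0" by (simp add: star_def mult.assoc[symmetric])
      then have "r c p (- \<i> * X) \<noteq> q c p (- \<i> * X)" by (simp add: r_def)
      with \<open>r = q\<close> show False by simp
    qed
  next
    assume not: "\<not> isothermic A \<Lambda>"
    have "r = q" if r: "multiplier A \<Lambda> r" for r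
    proof (rule ccontr)
      assume "r \<noteq> q"
      define \<delta> where "\<delta> = (\<lambda>c p X. r c p X - q c p X)"
      have \<delta>: "one_form A \<delta>"
        unfolding \<delta>_def using q r A by (intro one_form_diff) (simp_all add: mult_iff)
      have "values_in A \<delta> (\<lambda>p. wedge_space (\<Lambda> p) (first_derived A \<Lambda> p))"
        using q r unfolding mult_iff \<delta>_def values_in_def
        by (auto intro: subspace_diff subspace_wedge_space)
      then have v: "values_in A \<delta> (\<lambda>p. wedge_space (\<Lambda> p) (mink_perp (\<Lambda> p)))"
        unfolding values_in_def using wedge_space_mono[OF first_derived_perp[OF surf]] by blast
      have D: "ext_D S \<delta> c p X Y = 0" if "c \<in> A" "p \<in> fst c" for c p X Y
        using q r that ext_D_add_diff(2)[of r q c p X Y] by (simp add: mult_iff \<delta>_def)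
      have L: "lie_wedge \<delta> sN c p X Y = 0" if "c \<in> A" "p \<in> fst c" for c p X Y
      proof -
        have "lie_wedge \<delta> sN c p X Y = lie_wedge r sN c p X Y - lie_wedge q sN c p X Y"
          by (simp add: lie_wedge_def \<delta>_def lie.diff_left)
        \<comment> \<open>Both sides equal \<open>ext_D S sN c p X Y\<close>, which does not involve
          the multiplier.\<close>
        moreover have "2 *\<^sub>R lie_wedge r sN c p X Y = 2 *\<^sub>R lie_wedge q sN c p X Y"
          using q r that unfolding mult_iff by metis
        ultimately show ?thesis by simp
      qed
      have closed: "ext_d (star \<delta>) c p X Y = 0" if "c \<in> A" "p \<in> fst c" for c p X Y
        by (rule star_closed[OF surf \<delta> v _ _ that]) (simp_all add: D L flip: S_def sN_def)
      obtain c p X where nz: "\<delta> c p X \<noteq> 0" using \<open>r \<noteq> q\<close> by (force simp: \<delta>_def fun_eq_iff)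
      \<comment> \<open>Forms vanish outside the atlas by convention, so a nonzero value is attained
        in a chart, where the definition of isothermic asks for it.\<close>
      then have c: "c \<in> A" "p \<in> fst c" using one_form_outside[OF \<delta>] by blast+
      have "star \<delta> c p (- \<i> * X) \<noteq> 0" using nz by (simp add: star_def mult.assoc[symmetric])
      then have "isothermic A \<Lambda>"
        unfolding isothermic_def using one_form_star[OF A \<delta>] values_in_star[OF v] closed c by blast
      with not show False by simp
    qed
    with q show "\<exists>!q. multiplier A \<Lambda> q" by blast
  qed
qed

end
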